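(* Fix $m\in\mathbb{N}$, an infinite $N\in{}^*\mathbb{N}$, $k\in{}^*\mathbb{N}$, and an additive cut $U\subseteq[1,N]$. Let $U_N$ be the largest additive cut contained in $[1,N]$ and fix $c\in{}^*\mathbb{N}$ with $U<c<U_N$ (i.e. $c\in U_N\setminus U$). For each $[a]\in\mathcal{G}_{k,N,m}$ set $T_c([a]):=[(\lceil\sqrt[m]{a}\rceil+c)^m]$. Then $T_c$ is an $\mathfrak{m}$-measure preserving transformation on $\mathcal{G}_{k,N,m}$.
   Context: Work in a countably saturated nonstandard extension; ${}^*\mathbb{N}$ are the hypernaturals, $\mathrm{st}$ the standard part, intervals $[a,b]$ are sets of hypernaturals. An additive cut is an infinite initial segment of ${}^*\mathbb{N}$ closed under addition. Let $I_{k,N,m}:=[k,(\lceil\sqrt[m]{k}\rceil+N)^m]$. For $a,b\in I_{k,N,m}$, set $a\sim b$ iff $|\sqrt[m]{a}-\sqrt[m]{b}|<u$ for some $u\in U$; this is an equivalence relation, $[a]$ denotes the class of $a$ in $I_{k,N,m}$, $\mathcal{G}_{k,N,m}=\{[a]:a\in I_{k,N,m}\}$, and $\varphi(a)=[a]$ is the quotient map. For internal $A\subseteq I_{k,N,m}$ let $\nu(A)=\mathrm{st}\big(\frac{1}{mN}\sum_{a\in A}a^{-\frac{m-1}{m}}\big)$, extended to its Loeb measure $\nu$. A set $E\subseteq\mathcal{G}_{k,N,m}$ is $\mathfrak{m}$-measurable if $\varphi^{-1}(E)$ is Loeb measurable, and then $\mathfrak{m}(E)=\nu(\varphi^{-1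}(E))$.
   Formalization: Near the right end of I_{k,N,m} the point (⌈√[m]{a}⌉+c)^m leaves the interval, so T_c([a]) is undefined there; the formal version proves T_c is well defined almost everywhere and that every total map on G_{k,N,m} agreeing with the formula where it makes sense preserves 𝔪. *)

theory Defs
  imports "HOL-Analysis.Analysis"
begin

section \<open>Countably saturated nonstandard extensions\<close>

text \<open>
  The standard universe is the initial part \<open>\<real> \<union> P(\<real>)\<close> of the superstructure over the reals; it is
  regarded as a first-order structure in its full language, with a symbol for each of its relations.
  A nonstandard extension is an elementary extension of it (the transfer principle).  Restricting
  an extension of the whole superstructure yields one in this sense.
\<close>

datatype univ = Real real | RSet "real set"

datatype 'u fm =
    Rel "'u list set" "nat list"
  | Eq nat nat
  | Neg "'u fm"
  | Conj "'u fm" "'u fm"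
  | Exi nat "'u fm"

primrec holds :: "('u list set \<Rightarrow> 'd list set) \<Rightarrow> 'u fm \<Rightarrow> (nat \<Rightarrow> 'd) \<Rightarrow> bool" where
  "holds I (Rel R xs) e \<longleftrightarrow> map e xs \<in> I R"
| "holds I (Eq i j) e \<longleftrightarrow> e i = e j"
| "holds I (Neg p) e \<longleftrightarrow> \<not> holds I p e"
| "holds I (Conj p q) e \<longleftrightarrow> holds I p e \<and> holds I q e"
| "holds I (Exi i p) e \<longleftrightarrow> (\<exists>d. holds I p (e(i := d)))"

text \<open>
  \<open>star R\<close> is the extension of the relation \<open>R\<close> and \<open>std\<close> the embedding of the standard universe.
  The internal subsets of the extended universe are the sections \<open>{x. x # p \<in> star R}\<close>, so the
  second axiom says that a countable family of internal sets with the finite intersection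
  property has a common element.
\<close>

class countably_saturated_extension =
  fixes star :: "univ list set \<Rightarrow> 'a list set"
    and std :: "univ \<Rightarrow> 'a"
  assumes transfer_principle: "holds (\<lambda>R. R) \<phi> e \<longleftrightarrow> holds star \<phi> (\<lambda>i. std (e i))"
    and countable_saturation:
      "(\<And>n::nat. \<exists>x. \<forall>i\<le>n. x # p i \<in> star (R i)) \<Longrightarrow> \<exists>x. \<forall>i. x # p i \<in> star (R i)"

text \<open>Natural numbers are positive throughout: cuts are initial segments contained in \<open>[1, N]\<close>.\<close>

definition hnats :: "'a::countably_saturated_extension set" where
  "hnats = {x. [x] \<in> star {[Real (real n)] | n. n \<ge> 1}}"

definition hfun1 :: "(real \<Rightarrow> real) \<Rightarrow> 'a \<Rightarrow> 'a::countably_saturated_extension" where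
  "hfun1 f x = (THE y. [x, y] \<in> star {[Real r, Real (f r)] | r. True})"

definition hfun2 :: "(real \<Rightarrow> real \<Rightarrow> real) \<Rightarrow> 'a \<Rightarrow> 'a \<Rightarrow> 'a::countably_saturated_extension" where
  "hfun2 f x y = (THE z. [x, y, z] \<in> star {[Real r, Real s, Real (f r s)] | r s. True})"

definition hle :: "'a::countably_saturated_extension \<Rightarrow> 'a \<Rightarrow> bool" (infix "\<le>\<^sub>\<star>" 50) where
  "x \<le>\<^sub>\<star> y \<longleftrightarrow> [x, y] \<in> star {[Real r, Real s] | r s. r \<le> s}"

definition hless :: "'a::countably_saturated_extension \<Rightarrow> 'a \<Rightarrow> bool" (infix "<\<^sub>\<star>" 50) where
  "x <\<^sub>\<star> y \<longleftrightarrow> [x, y] \<in> star {[Real r, Real s] | r s. r < s}"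

definition hadd :: "'a \<Rightarrow> 'a \<Rightarrow> 'a::countably_saturated_extension" (infixl "+\<^sub>\<star>" 65) where
  "x +\<^sub>\<star> y = hfun2 (\<lambda>r s. r + s) x y"

definition hdist :: "'a \<Rightarrow> 'a \<Rightarrow> 'a::countably_saturated_extension" where
  "hdist x y = hfun2 (\<lambda>r s. \<bar>r - s\<bar>) x y"

definition hroot :: "nat \<Rightarrow> 'a \<Rightarrow> 'a::countably_saturated_extension" where
  "hroot m x = hfun1 (root m) x"

definition hceiling :: "'a \<Rightarrow> 'a::countably_saturated_extension" where
  "hceiling x = hfun1 (\<lambda>r. of_int \<lceil>r\<rceil>) x"

definition hpower :: "'a \<Rightarrow> nat \<Rightarrow> 'a::countably_saturated_extension" where
  "hpower x m = hfun1 (\<lambda>r. r ^ m) x"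

definition st :: "'a::countably_saturated_extension \<Rightarrow> real" where
  "st x = (THE r. \<forall>e>0. hdist x (std (Real r)) <\<^sub>\<star> std (Real e))"

definition infinite_number :: "'a::countably_saturated_extension \<Rightarrow> bool" where
  "infinite_number x \<longleftrightarrow> (\<forall>n::nat. std (Real (real n)) <\<^sub>\<star> x)"

definition hinterval :: "'a \<Rightarrow> 'a \<Rightarrow> 'a::countably_saturated_extension set" where
  "hinterval a b = {x \<in> hnats. a \<le>\<^sub>\<star> x \<and> x \<le>\<^sub>\<star> b}"

text \<open>
  Internal sets of hyperreals are the elements of the extension of \<open>P(\<real>)\<close>; \<open>hset s\<close> is the set of
  hyperreals coded by such an element \<open>s\<close>.
\<close>

definition hset :: "'a::countably_saturated_extension \<Rightarrow> 'a set" where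
  "hset s = {x. [x, s] \<in> star {[Real r, RSet B] | r B. r \<in> B}}"

definition internal :: "'a::countably_saturated_extension set \<Rightarrow> bool" where
  "internal A \<longleftrightarrow> (\<exists>s. [s] \<in> star {[RSet B] | B. True} \<and> A = hset s)"

text \<open>The internal sum over an internal (hyperfinite) set: the extension of \<open>B \<mapsto> (\<Sum>a\<in>B. f a)\<close>.\<close>

definition hsum :: "(real \<Rightarrow> real) \<Rightarrow> 'a set \<Rightarrow> 'a::countably_saturated_extension" where
  "hsum f A = (THE y. \<exists>s. A = hset s \<and> [s, y] \<in> star {[RSet B, Real (\<Sum>a\<in>B. f a)] | B. True})"


section \<open>Cuts and the quotient of a power interval\<close>

definition additive_cut :: "'a::countably_saturated_extension set \<Rightarrow> bool" where
  "additive_cut U \<longleftrightarrow> U \<subseteq> hnats \<and> infinite U \<and>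
     (\<forall>x\<in>U. \<forall>y\<in>hnats. y \<le>\<^sub>\<star> x \<longrightarrow> y \<in> U) \<and> (\<forall>x\<in>U. \<forall>y\<in>U. x +\<^sub>\<star> y \<in> U)"

definition largest_additive_cut :: "'a \<Rightarrow> 'a::countably_saturated_extension set \<Rightarrow> bool" where
  "largest_additive_cut N V \<longleftrightarrow>
     additive_cut V \<and> V \<subseteq> hinterval (std (Real 1)) N \<and>
     (\<forall>W. additive_cut W \<and> W \<subseteq> hinterval (std (Real 1)) N \<longrightarrow> W \<subseteq> V)"

definition power_interval :: "'a \<Rightarrow> 'a \<Rightarrow> nat \<Rightarrow> 'a::countably_saturated_extension set" where
  "power_interval k N m = hinterval k (hpower (hceiling (hroot m k) +\<^sub>\<star> N) m)"

definition cut_equiv :: "nat \<Rightarrow> 'a set \<Rightarrow> 'a::countably_saturated_extension \<Rightarrow> 'a \<Rightarrow> bool" where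
  "cut_equiv m U a b \<longleftrightarrow> (\<exists>u\<in>U. hdist (hroot m a) (hroot m b) <\<^sub>\<star> u)"

definition cut_class :: "'a \<Rightarrow> 'a \<Rightarrow> nat \<Rightarrow> 'a set \<Rightarrow> 'a \<Rightarrow> 'a::countably_saturated_extension set" where
  "cut_class k N m U a = {b \<in> power_interval k N m. cut_equiv m U a b}"

definition cut_quotient :: "'a \<Rightarrow> 'a \<Rightarrow> nat \<Rightarrow> 'a set \<Rightarrow> 'a::countably_saturated_extension set set" where
  "cut_quotient k N m U = cut_class k N m U ` power_interval k N m"

definition power_density :: "'a \<Rightarrow> nat \<Rightarrow> 'a::countably_saturated_extension set \<Rightarrow> real" where
  "power_density N m A =
     st (hfun2 (\<lambda>n s. 1 / (real m * n) * s) N (hsum (\<lambda>a. a powr (- ((real m - 1) / real m))) A))"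

text \<open>
  The Loeb measure: the completion of the (unique) countably additive extension of
  \<open>power_density\<close> from the algebra of internal sets to the generated sigma-algebra.
\<close>

definition loeb_measure :: "'a \<Rightarrow> 'a \<Rightarrow> nat \<Rightarrow> 'a::countably_saturated_extension measure" where
  "loeb_measure k N m =
     completion (extend_measure (power_interval k N m)
       {A. internal A \<and> A \<subseteq> power_interval k N m} (\<lambda>A. A) (\<lambda>A. ennreal (power_density N m A)))"

definition cut_measure ::
    "'a \<Rightarrow> 'a \<Rightarrow> nat \<Rightarrow> 'a set \<Rightarrow> 'a::countably_saturated_extension set measure" where
  "cut_measure k N m U =
     measure_of (cut_quotient k N m U)
       {E. E \<subseteq> cut_quotient k N m U \<and>
           cut_class k N m U -` E \<inter> power_interval k N m \<in> sets (loeb_measure k N m)}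
       (\<lambda>E. emeasure (loeb_measure k N m) (cut_class k N m U -` E \<inter> power_interval k N m))"

definition root_shift :: "nat \<Rightarrow> 'a \<Rightarrow> 'a \<Rightarrow> 'a::countably_saturated_extension" where
  "root_shift m c a = hpower (hceiling (hroot m a) +\<^sub>\<star> c) m"

definition measure_preserving_transformation :: "'b measure \<Rightarrow> ('b \<Rightarrow> 'b) \<Rightarrow> bool" where
  "measure_preserving_transformation M T \<longleftrightarrow>
     T \<in> measurable M M \<and> (\<forall>E\<in>sets M. emeasure M (T -` E \<inter> space M) = emeasure M E)"

end

theory Submission
  imports Defs
begin

text \<open>
  Every finite tuple \<open>p\<close> of the extension induces an ultrafilter on the standard tuples, namely
  \<open>{R. p \<in> star R}\<close>, and the elements definable from \<open>p\<close> are the values at \<open>p\<close> of standard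
  functions.  By Los's theorem, internal statements about such elements are statements that hold
  eventually along this filter, and standard parts are limits along it.

  Put \<open>h a = root m a - root m (a - 1)\<close>.  The weight \<open>w a = a powr (- (m - 1) / m)\<close> satisfies
  \<open>0 \<le> m * h a - w a \<le> w (a - 1) - w a\<close> for \<open>a > 1\<close>, so by telescoping replacing \<open>w\<close> by
  \<open>m * h\<close> changes the sum over any set by at most \<open>m\<close>, which is negligible after division by
  \<open>m * N\<close>.  The sum of \<open>h\<close> over a block \<open>{a. \<lceil>root m a\<rceil> = j}\<close> is \<open>1\<close> (except possibly for the first
  block), so the density of a union of blocks is infinitely close to the number of blocks divided
  by \<open>N\<close>.  The map \<open>a \<mapsto> (\<lceil>root m a\<rceil> + c) ^ m\<close> translates blocks by \<open>c\<close>, hence changes this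
  number by at most \<open>c\<close>, and \<open>c / N\<close> is infinitesimal because \<open>c\<close> lies in an additive cut
  contained in \<open>[1, N]\<close>.

  By saturation every Loeb measurable set can be approximated from inside and outside by internal
  sets.  The preimage of a subset of the quotient is a union of blocks, so the approximating sets
  may be replaced by unions of blocks (hull from inside, kernel from outside), for which the
  previous paragraph applies.
\<close>

section \<open>Transfer along tuples\<close>

definition fm_iff :: "'u fm \<Rightarrow> 'u fm \<Rightarrow> 'u fm" where
  "fm_iff p q = Conj (Neg (Conj p (Neg q))) (Neg (Conj q (Neg p)))"

lemma holds_fm_iff [simp]: "holds I (fm_iff p q) e \<longleftrightarrow> (holds I p e \<longleftrightarrow> holds I q e)"
  by (auto simp: fm_iff_def)

lemma holds_foldr_Exi:
  "holds I (foldr Exi is \<phi>) e \<longleftrightarrow> (\<exists>e'. (\<forall>i. i \<notin> set is \<longrightarrow> e' i = e i) \<and> holds I \<phi> e')"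
proof (induction "is" arbitrary: e)
  case Nil
  have "e' = e" if "\<forall>i. e' i = e i" for e' using that by auto
  then show ?case by auto
next
  case (Cons j js)
  show ?case
  proof
    assume "holds I (foldr Exi (j # js) \<phi>) e"
    then obtain d e' where "\<forall>i. i \<notin> set js \<longrightarrow> e' i = (e(j := d)) i" "holds I \<phi> e'"
      using Cons.IH by auto
    then show "\<exists>e'. (\<forall>i. i \<notin> set (j # js) \<longrightarrow> e' i = e i) \<and> holds I \<phi> e'"
      by (intro exI[of _ e']) auto
  next
    assume "\<exists>e'. (\<forall>i. i \<notin> set (j # js) \<longrightarrow> e' i = e i) \<and> holds I \<phi> e'"
    then obtain e' where e': "\<forall>i. i \<notin> set (j # js) \<longrightarrow> e' i = e i" "holds I \<phi> e'" by auto
    then have "holds I (foldr Exi js \<phi>) (e(j := e' j))"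
      by (subst Cons.IH) (intro exI[of _ e'], auto)
    then show "holds I (foldr Exi (j # js) \<phi>) e" by auto
  qed
qed

text \<open>The universal closure over the first \<open>n\<close> variables is one formula, a
  negated block of existential quantifiers; transferring it at the standard environment
  \<open>e0\<close> covers all nonstandard values of these variables.\<close>

lemma transfer_universal:
  fixes e' :: "nat \<Rightarrow> 'a::countably_saturated_extension"
  assumes "\<And>e. (\<And>i. i \<ge> n \<Longrightarrow> e i = e0 i) \<Longrightarrow> holds (\<lambda>R. R) \<phi> e"
    and "\<And>i. i \<ge> n \<Longrightarrow> e' i = std (e0 i)"
  shows "holds star \<phi> e'"
proof -
  have "holds (\<lambda>R. R) (Neg (foldr Exi [0..<n] (Neg \<phi>))) e0"
    using assms(1) by (auto simp: holds_foldr_Exi not_less)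
  then have "holds star (Neg (foldr Exi [0..<n] (Neg \<phi>))) (\<lambda>i. std (e0 i) :: 'a)"
    using transfer_principle by blast
  then show ?thesis using assms(2) by (auto simp: holds_foldr_Exi not_less)
qed

lemma transfer_list:
  fixes p :: "'a::countably_saturated_extension list"
  assumes "\<And>xs. length xs = length p \<Longrightarrow>
             holds (\<lambda>R. R) \<phi> (\<lambda>i. if i < length p then xs ! i else e0 i)"
  shows "holds star \<phi> (\<lambda>i. if i < length p then p ! i else std (e0 i))"
proof (rule transfer_universal[where n = "length p" and ?e0.0 = e0])
  fix e :: "nat \<Rightarrow> univ"
  assume e: "\<And>i. i \<ge> length p \<Longrightarrow> e i = e0 i"
  have "e = (\<lambda>i. if i < length p then map e [0..<length p] ! i else e0 i)"
    using e by (auto simp: fun_eq_iff)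
  then show "holds (\<lambda>R. R) \<phi> e"
    using assms[of "map e [0..<length p]"] by simp
qed auto

lemma map_env_upt: "n \<le> length xs \<Longrightarrow> map (\<lambda>i. if i < length xs then xs ! i else e i) [0..<n] = take n xs"
  by (auto intro!: nth_equalityI)

lemma map_env_nth: "set is \<subseteq> {..<length xs} \<Longrightarrow>
    map (\<lambda>i. if i < length xs then xs ! i else e i) is = map ((!) xs) is"
  by auto

text \<open>Substituting variables is a first-order operation, so repeating, permuting or dropping
  coordinates can be absorbed into the relation.\<close>

lemma star_reindex:
  fixes p :: "'a::countably_saturated_extension list"
  assumes "set is \<subseteq> {..<length p}"
  shows "map ((!) p) is \<in> star R \<longleftrightarrow> p \<in> star {xs. map ((!) xs) is \<in> R}"
proof -
  have "holds star (fm_iff (Rel R is) (Rel {xs. map ((!) xs) is \<in> R} [0..<length p]))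
          (\<lambda>i. if i < length p then p ! i else std (Real 0))"
  proof (rule transfer_list, goal_cases)
    case (1 xs)
    then have *: "set is \<subseteq> {..<length xs}" and l: "length p = length xs" using assms by auto
    show ?case unfolding l holds_fm_iff holds.simps map_env_nth[OF *] by (simp add: map_env_upt)
  qed
  then show ?thesis unfolding holds_fm_iff holds.simps map_env_nth[OF assms] by (simp add: map_env_upt)
qed

text \<open>Together with \<open>star_Int\<close>, \<open>star_UNIV\<close> and
  \<open>star_mono\<close> this makes the relations whose extension contains \<open>p\<close> an
  ultrafilter.\<close>

lemma star_Compl: "p \<in> star (- R) \<longleftrightarrow> p \<notin> star R"
  for p :: "'a::countably_saturated_extension list"
proof -
  have "holds star (fm_iff (Rel (- R) [0..<length p]) (Neg (Rel R [0..<length p])))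
          (\<lambda>i. if i < length p then p ! i else std (Real 0))"
    by (rule transfer_list) simp
  then show ?thesis using map_env_upt[of "length p" p] by simp
qed

lemma star_Int: "p \<in> star (R \<inter> S) \<longleftrightarrow> p \<in> star R \<and> p \<in> star S"
  for p :: "'a::countably_saturated_extension list"
proof -
  have "holds star (fm_iff (Rel (R \<inter> S) [0..<length p])
            (Conj (Rel R [0..<length p]) (Rel S [0..<length p])))
          (\<lambda>i. if i < length p then p ! i else std (Real 0))"
    by (rule transfer_list) simp
  then show ?thesis using map_env_upt[of "length p" p] by simp
qed

lemma star_UNIV: "p \<in> star UNIV"
  for p :: "'a::countably_saturated_extension list"
proof -
  have "holds star (Rel UNIV [0..<length p])
          (\<lambda>i. if i < length p then p ! i else std (Real 0))"
    by (rule transfer_list) simp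
  then show ?thesis using map_env_upt[of "length p" p] by simp
qed

lemma star_length: "p \<in> star {xs. length xs = length p}"
  for p :: "'a::countably_saturated_extension list"
proof -
  have "holds star (Rel {xs. length xs = length p} [0..<length p])
          (\<lambda>i. if i < length p then p ! i else std (Real 0))"
    by (rule transfer_list) simp
  then show ?thesis using map_env_upt[of "length p" p] by simp
qed

lemma star_mono: "R \<subseteq> S \<Longrightarrow> p \<in> star R \<Longrightarrow> p \<in> star S"
  for p :: "'a::countably_saturated_extension list"
  using star_Int[of p R S] by (simp add: Int_absorb2)

text \<open>Packaging the ultrafilter as a library filter makes \<open>eventually\<close>,
  \<open>filterlim\<close> and the limit lemmas available for standard parts.\<close>

definition type_filter :: "'a::countably_saturated_extension list \<Rightarrow> univ list filter" where
  "type_filter p = Abs_filter (\<lambda>P. p \<in> star {xs. P xs})"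

lemma eventually_type_filter: "eventually P (type_filter p) \<longleftrightarrow> p \<in> star {xs. P xs}"
proof -
  have "is_filter (\<lambda>P. p \<in> star {xs. P xs})"
    by (rule is_filter.intro)
       (auto simp: star_UNIV star_Int Collect_conj_eq intro: star_mono[rotated])
  then show ?thesis by (simp add: type_filter_def eventually_Abs_filter)
qed

lemma type_filter_ultra: "eventually (\<lambda>xs. \<not> P xs) (type_filter p) \<longleftrightarrow> \<not> eventually P (type_filter p)"
  by (simp add: eventually_type_filter Collect_neg_eq star_Compl)

lemma type_filter_neq_bot [simp]: "type_filter p \<noteq> bot"
  using type_filter_ultra[of "\<lambda>_. True" p] by (auto simp flip: eventually_False)

lemma type_filter_length: "eventually (\<lambda>xs. length xs = length p) (type_filter p)"
  by (simp add: eventually_type_filter star_length)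

section \<open>Values of standard functions at a tuple, and Los's theorem\<close>

definition ext :: "'a::countably_saturated_extension list \<Rightarrow> (univ list \<Rightarrow> univ) \<Rightarrow> 'a" where
  "ext p f = (THE y. y # p \<in> star {f xs # xs | xs. True})"

text \<open>The variable numbered \<open>length p\<close> is free for the value, so totality of the
  graph of \<open>f\<close> is a single existential formula to transfer.\<close>

lemma ext_exists: "\<exists>y. y # p \<in> star {f xs # xs | xs. True}"
  for p :: "'a::countably_saturated_extension list"
proof -
  let ?n = "length p"
  have eq: "map ((\<lambda>i. if i < n then xs ! i else e i)(n := y)) (n # [0..<n]) = y # xs"
    if "length xs = n" for xs :: "'b list" and n y e
    using that by (auto intro!: nth_equalityI)
  have "holds star (Exi ?n (Rel {f xs # xs | xs. True} (?n # [0..<?n])))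
          (\<lambda>i. if i < length p then p ! i else std (Real 0))"
  proof (rule transfer_list, goal_cases)
    case (1 xs)
    show ?case unfolding holds.simps eq[OF 1] by blast
  qed
  then show ?thesis unfolding holds.simps eq[OF refl] .
qed

lemma ext_unique:
  fixes p :: "'a::countably_saturated_extension list"
  assumes "y # p \<in> star {f xs # xs | xs. True}" "z # p \<in> star {f xs # xs | xs. True}"
  shows "y = z"
proof -
  let ?G = "{f xs # xs | xs. True}" and ?n = "length p"
  \<comment> \<open>The two candidate values occupy variables 0 and 1, with the tuple placed behind
    them.\<close>
  have env_eq: "map (\<lambda>i. if i < Suc (Suc n) then (v # w # xs) ! i else e i) (0 # [2..<Suc (Suc n)]) = v # xs"
       "map (\<lambda>i. if i < Suc (Suc n) then (v # w # xs) ! i else e i) (1 # [2..<Suc (Suc n)]) = w # xs"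
    if "length xs = n" for v w n e and xs :: "'b list"
    using that by (auto intro!: nth_equalityI simp del: upt_Suc)
  have "holds star (Neg (Conj (Conj (Rel ?G (0 # [2..<Suc (Suc ?n)])) (Rel ?G (1 # [2..<Suc (Suc ?n)]))) (Neg (Eq 0 1))))
          (\<lambda>i. if i < length (y # z # p) then (y # z # p) ! i else std (Real 0))"
  proof (rule transfer_list, goal_cases)
    case (1 xs)
    then obtain v w ys where xs: "xs = v # w # ys" "length ys = ?n"
      by (auto simp: length_Suc_conv)
    show ?case unfolding holds.simps xs length_Cons env_eq[OF xs(2)] by auto
  qed
  then show ?thesis using assms unfolding holds.simps length_Cons env_eq[OF refl] by auto
qed

lemma ext_graph: "ext p f # p \<in> star {f xs # xs | xs. True}"
  unfolding ext_def by (rule theI', rule ex_ex1I[OF ext_exists]) (rule ext_unique)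

lemma ext_eqI: "y # p \<in> star {f xs # xs | xs. True} \<Longrightarrow> ext p f = y"
  using ext_graph ext_unique by blast

text \<open>The values are put in front of \<open>p\<close> to form a longer tuple
  \<open>?q\<close>. Along its filter the leading coordinates are the functions \<open>fs\<close> of
  the trailing ones, so a relation between values becomes a relation on the trailing part alone,
  which is \<open>p\<close>.\<close>

theorem Los:
  fixes p :: "'a::countably_saturated_extension list"
  shows "map (ext p) fs \<in> star R \<longleftrightarrow> eventually (\<lambda>xs. map (\<lambda>f. f xs) fs \<in> R) (type_filter p)"
proof -
  let ?l = "length fs" and ?n = "length p"
  let ?q = "map (ext p) fs @ p"
  let ?F = "type_filter ?q"
  have reindex: "map ((!) ?q) is \<in> star S \<longleftrightarrow> eventually (\<lambda>xs. map ((!) xs) is \<in> S) ?F"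
    if "set is \<subseteq> {..<?l + ?n}" for "is" S
    using star_reindex[of "is" ?q S] that by (simp add: eventually_type_filter)
  have len: "eventually (\<lambda>xs. length xs = ?l + ?n) ?F"
    using type_filter_length[of ?q] by simp
  have take_eq: "map ((!) xs) [0..<?l] = take ?l xs" and drop_eq: "map ((!) xs) [?l..<?l+?n] = drop ?l xs"
    if "length xs = ?l + ?n" for xs :: "'c list"
    using that by (auto intro!: nth_equalityI)
  have "eventually (\<lambda>xs. xs ! j = (fs ! j) (drop ?l xs)) ?F" if "j < ?l" for j
  proof -
    have "map ((!) ?q) (j # [?l..<?l + ?n]) = ext p (fs ! j) # p"
      using that drop_eq[of ?q] by (simp add: nth_append)
    then have "eventually (\<lambda>xs. map ((!) xs) (j # [?l..<?l + ?n]) \<in> {(fs ! j) xs # xs | xs. True}) ?F"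
      using reindex[of "j # [?l..<?l + ?n]" "{(fs ! j) xs # xs | xs. True}"] ext_graph[of p "fs ! j"] that
      by (simp add: subset_eq)
    then show ?thesis using len by eventually_elim (auto simp: drop_eq)
  qed
  then have "eventually (\<lambda>xs. \<forall>j\<in>{..<?l}. xs ! j = (fs ! j) (drop ?l xs)) ?F"
    by (intro eventually_ball_finite) auto
  then have take: "eventually (\<lambda>xs. take ?l xs = map (\<lambda>f. f (drop ?l xs)) fs) ?F"
    using len by eventually_elim (rule nth_equalityI, auto)
  have "map (ext p) fs = map ((!) ?q) [0..<?l]" by (simp add: take_eq)
  then have "map (ext p) fs \<in> star R \<longleftrightarrow> eventually (\<lambda>xs. map ((!) xs) [0..<?l] \<in> R) ?F"
    using reindex[of "[0..<?l]" R] by (simp add: subset_eq)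
  also have "\<dots> \<longleftrightarrow> eventually (\<lambda>xs. map (\<lambda>f. f (map ((!) xs) [?l..<?l+?n])) fs \<in> R) ?F"
  proof (rule eventually_cong)
    show "eventually (\<lambda>xs. take ?l xs = map (\<lambda>f. f (drop ?l xs)) fs \<and> length xs = ?l + ?n) ?F"
      using take len by eventually_elim auto
  qed (auto simp: take_eq drop_eq)
  also have "\<dots> \<longleftrightarrow> map ((!) ?q) [?l..<?l+?n] \<in> star {xs. map (\<lambda>f. f xs) fs \<in> R}"
    by (subst reindex) auto
  also have "map ((!) ?q) [?l..<?l+?n] = p" by (simp add: drop_eq)
  finally show ?thesis by (simp add: eventually_type_filter)
qed

lemma ext_eq_iff: "ext p f = ext p g \<longleftrightarrow> eventually (\<lambda>xs. f xs = g xs) (type_filter p)"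
proof
  assume "ext p f = ext p g"
  then have "map (ext p) [f, \<lambda>xs. g xs] \<in> star {[x, y] | x y. x = y}"
  proof -
    have "map (ext p) [f, f] \<in> star {[x, y] | x y. x = y}" by (subst Los) simp
    then show ?thesis using \<open>ext p f = ext p g\<close> by simp
  qed
  then show "eventually (\<lambda>xs. f xs = g xs) (type_filter p)" by (subst (asm) Los) (simp add: eq_commute)
next
  assume ev: "eventually (\<lambda>xs. f xs = g xs) (type_filter p)"
  have "map (ext p) [f, g] \<in> star {[x, y] | x y. x = y}" using ev by (subst Los) (simp add: eq_commute)
  \<comment> \<open>\<open>Eq\<close> is interpreted as true equality, so transfer shows that the
    extension of the equality relation contains only pairs of equal elements.\<close>
  moreover have "holds star (Neg (Conj (Rel {[x, y] | x y. x = y} [0, 1]) (Neg (Eq 0 1))))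
       (\<lambda>i. if i < length [ext p f, ext p g] then [ext p f, ext p g] ! i else std (Real 0))"
    by (rule transfer_list) auto
  ultimately show "ext p f = ext p g" by auto
qed

lemma ext_nth: "i < length p \<Longrightarrow> ext p (\<lambda>xs. xs ! i) = p ! i"
proof (rule ext_eqI)
  assume i: "i < length p"
  have *: "map ((!) xs) [0..<length p] = xs" if "length xs = length p" for xs :: "'c list"
    using that by (auto intro!: nth_equalityI)
  have "map ((!) p) (i # [0..<length p]) \<in> star {xs ! i # xs | xs. True}"
  proof (subst star_reindex)
    show "p \<in> star {xs. map ((!) xs) (i # [0..<length p]) \<in> {xs ! i # xs | xs. True}}"
      unfolding eventually_type_filter[symmetric]
      using type_filter_length[of p] by eventually_elim (simp add: *)
  qed (use i in auto)
  then show "p ! i # p \<in> star {xs ! i # xs | xs. True}" by (simp add: *)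
qed

lemma ext_const [simp]: "ext p (\<lambda>_. u) = std u"
proof (rule ext_eqI)
  have *: "map (\<lambda>i. if i < n then xs ! i else w) (n # [0..<n]) = w # xs"
    if "length xs = n" for xs :: "'c list" and n w
    using that by (auto intro!: nth_equalityI)
  have "holds star (Rel {u # xs | xs. True} (length p # [0..<length p]))
          (\<lambda>i. if i < length p then p ! i else std u)"
  proof (rule transfer_list[where ?e0.0 = "\<lambda>_. u"], goal_cases)
    case (1 xs)
    show ?case unfolding holds.simps *[OF 1] by blast
  qed
  then show "std u # p \<in> star {u # xs | xs. True}" unfolding holds.simps *[OF refl] .
qed

text \<open>Lets a tuple be enlarged by a new element without losing the elements already
  represented over it.\<close>

lemma ext_Cons: "ext (x # p) (\<lambda>xs. f (tl xs)) = ext p f"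
proof (rule ext_eqI)
  let ?q = "ext p f # x # p"
  have shift: "map ((!) (y # z # xs)) (0 # [2..<length xs + 2]) = y # xs" for y z and xs :: "'c list"
    by (auto intro!: nth_equalityI simp del: upt_Suc)
  have "map ((!) ?q) (0 # [2..<length p + 2]) \<in> star {f xs # xs | xs. True}"
    unfolding shift by (rule ext_graph)
  then have "eventually (\<lambda>xs. map ((!) xs) (0 # [2..<length p + 2]) \<in> {f xs # xs | xs. True})
      (type_filter ?q)"
    unfolding eventually_type_filter by (subst (asm) star_reindex) auto
  then have "eventually (\<lambda>xs. xs \<in> {f (tl xs) # xs | xs. True}) (type_filter ?q)"
    using type_filter_length[of ?q]
  proof eventually_elim
    case (elim xs)
    then obtain y z ys where xs: "xs = y # z # ys" "length p = length ys"
      by (auto simp: length_Suc_conv)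
    show ?case using elim unfolding xs shift by auto
  qed
  then show "?q \<in> star {f (tl xs) # xs | xs. True}"
    by (simp add: eventually_type_filter)
qed

section \<open>Hyperreals and internal sets as values at a tuple\<close>

text \<open>The defaults, 0 here and \<open>{}\<close> in \<open>set_of_univ\<close>, only make the
  coordinates total: at a hyperreal or at a code they are met on a set that is negligible for the
  ultrafilter.\<close>

definition real_of_univ :: "univ \<Rightarrow> real" where
  "real_of_univ u = (case u of Real r \<Rightarrow> r | RSet _ \<Rightarrow> 0)"

definition set_of_univ :: "univ \<Rightarrow> real set" where
  "set_of_univ u = (case u of Real _ \<Rightarrow> {} | RSet B \<Rightarrow> B)"

lemma of_univ_simps [simp]: "real_of_univ (Real r) = r" "set_of_univ (RSet B) = B"
  by (simp_all add: real_of_univ_def set_of_univ_def)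

definition hreals :: "'a::countably_saturated_extension set" where
  "hreals = {x. [x] \<in> star {[Real r] | r. True}}"

definition hcodes :: "'a::countably_saturated_extension set" where
  "hcodes = {x. [x] \<in> star {[RSet B] | B. True}}"

definition hreal :: "'a::countably_saturated_extension list \<Rightarrow> (univ list \<Rightarrow> real) \<Rightarrow> 'a" where
  "hreal p f = ext p (\<lambda>xs. Real (f xs))"

definition hcode :: "'a::countably_saturated_extension list \<Rightarrow> (univ list \<Rightarrow> real set) \<Rightarrow> 'a" where
  "hcode p S = ext p (\<lambda>xs. RSet (S xs))"

lemma hreal_const [simp]: "hreal p (\<lambda>_. r) = std (Real r)"
  by (simp add: hreal_def)

lemma hreal_eq_iff: "hreal p f = hreal p g \<longleftrightarrow> eventually (\<lambda>xs. f xs = g xs) (type_filter p)"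
  by (simp add: hreal_def ext_eq_iff)

lemma hcode_eq_iff: "hcode p S = hcode p T \<longleftrightarrow> eventually (\<lambda>xs. S xs = T xs) (type_filter p)"
  by (simp add: hcode_def ext_eq_iff)

lemma hreal_Cons: "hreal (x # p) (\<lambda>xs. f (tl xs)) = hreal p f"
  unfolding hreal_def using ext_Cons[of x p "\<lambda>xs. Real (f xs)"] .

lemma hcode_Cons: "hcode (x # p) (\<lambda>xs. f (tl xs)) = hcode p f"
  unfolding hcode_def using ext_Cons[of x p "\<lambda>xs. RSet (f xs)"] .

lemma Los1: "[ext p f] \<in> star R \<longleftrightarrow> eventually (\<lambda>xs. [f xs] \<in> R) (type_filter p)"
  using Los[of p "[f]" R] by simp

lemma Los2: "[ext p f, ext p g] \<in> star R \<longleftrightarrow> eventually (\<lambda>xs. [f xs, g xs] \<in> R) (type_filter p)"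
  using Los[of p "[f, g]" R] by simp

lemma Los3: "[ext p f, ext p g, ext p h] \<in> star R \<longleftrightarrow>
    eventually (\<lambda>xs. [f xs, g xs, h xs] \<in> R) (type_filter p)"
  using Los[of p "[f, g, h]" R] by simp

lemma hreal_in_hreals [simp]: "hreal p f \<in> hreals"
  by (simp add: hreals_def hreal_def Los1)

lemma hcode_in_hcodes [simp]: "hcode p S \<in> hcodes"
  by (simp add: hcodes_def hcode_def Los1)

lemma represent_nth:
  assumes "i < length p"
  shows "p ! i \<in> hreals \<Longrightarrow> p ! i = hreal p (\<lambda>xs. real_of_univ (xs ! i))"
    and "p ! i \<in> hcodes \<Longrightarrow> p ! i = hcode p (\<lambda>xs. set_of_univ (xs ! i))"
proof -
  have p: "p ! i = ext p (\<lambda>xs. xs ! i)" using assms by (simp add: ext_nth)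
  show "p ! i = hreal p (\<lambda>xs. real_of_univ (xs ! i))" if "p ! i \<in> hreals"
    using that unfolding p hreals_def hreal_def ext_eq_iff
    by (auto simp: Los1 elim!: eventually_mono)
  show "p ! i = hcode p (\<lambda>xs. set_of_univ (xs ! i))" if "p ! i \<in> hcodes"
    using that unfolding p hcodes_def hcode_def ext_eq_iff
    by (auto simp: Los1 elim!: eventually_mono)
qed

text \<open>The tuple is the concatenation of the two lists, whose entries are then coordinates.
  This puts finitely many given elements over one ultrafilter.\<close>

lemma represent:
  fixes rs ss :: "'a::countably_saturated_extension list"
  assumes "set rs \<subseteq> hreals" "set ss \<subseteq> hcodes"
  obtains p fs Ss where "rs = map (hreal p) fs" "ss = map (hcode p) Ss"
proof -
  let ?p = "rs @ ss"
  have "rs = map (hreal ?p) (map (\<lambda>i xs. real_of_univ (xs ! i)) [0..<length rs])"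
  proof (rule nth_equalityI)
    fix i assume i: "i < length rs"
    then have "?p ! i \<in> hreals" using assms by (auto simp: nth_append)
    then show "rs ! i = map (hreal ?p) (map (\<lambda>i xs. real_of_univ (xs ! i)) [0..<length rs]) ! i"
      using i represent_nth(1)[of i ?p] by (simp add: nth_append)
  qed simp
  moreover have "ss = map (hcode ?p) (map (\<lambda>i xs. set_of_univ (xs ! (length rs + i))) [0..<length ss])"
  proof (rule nth_equalityI)
    fix i assume i: "i < length ss"
    then have "?p ! (length rs + i) \<in> hcodes" using assms by (auto simp: nth_append)
    then show "ss ! i = map (hcode ?p) (map (\<lambda>i xs. set_of_univ (xs ! (length rs + i))) [0..<length ss]) ! i"
      using i represent_nth(2)[of "length rs + i" ?p] by (simp add: nth_append)
  qed simp
  ultimately show thesis by (rule that)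
qed

lemma represent_Cons:
  assumes "x \<in> hreals"
  shows "x = hreal (x # p) (\<lambda>xs. real_of_univ (hd xs))"
proof -
  have "x = hreal (x # p) (\<lambda>xs. real_of_univ (xs ! 0))"
    using represent_nth(1)[of 0 "x # p"] assms by simp
  also have "\<dots> = hreal (x # p) (\<lambda>xs. real_of_univ (hd xs))"
    using type_filter_length[of "x # p"]
    by (auto simp: hreal_eq_iff length_Suc_conv elim!: eventually_mono)
  finally show ?thesis .
qed

section \<open>Pointwise order and arithmetic of hyperreals\<close>

lemma hle_hreal: "hreal p f \<le>\<^sub>\<star> hreal p g \<longleftrightarrow> eventually (\<lambda>xs. f xs \<le> g xs) (type_filter p)"
  by (simp add: hle_def hreal_def Los2)

lemma hless_hreal: "hreal p f <\<^sub>\<star> hreal p g \<longleftrightarrow> eventually (\<lambda>xs. f xs < g xs) (type_filter p)"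
  by (simp add: hless_def hreal_def Los2)

text \<open>A competing value \<open>y\<close> in the \<open>THE\<close> need not be represented
  over \<open>p\<close>; over the longer tuple \<open>y # p\<close> it is, and the graph relation
  forces eventual equality.\<close>

lemma hfun1_hreal: "hfun1 F (hreal p f) = hreal p (\<lambda>xs. F (f xs))"
  unfolding hfun1_def
proof (rule the_equality)
  show "[hreal p f, hreal p (\<lambda>xs. F (f xs))] \<in> star {[Real r, Real (F r)] | r. True}"
    by (simp add: hreal_def Los2)
next
  fix y assume y: "[hreal p f, y] \<in> star {[Real r, Real (F r)] | r. True}"
  define f' where "f' = (\<lambda>xs. f (tl xs))"
  have q: "hreal p f = ext (y # p) (\<lambda>xs. Real (f' xs))"
    and y': "y = ext (y # p) (\<lambda>xs. xs ! 0)"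
    and q2: "hreal p (\<lambda>xs. F (f xs)) = ext (y # p) (\<lambda>xs. Real (F (f' xs)))"
    using hreal_Cons[of y p f] hreal_Cons[of y p "\<lambda>xs. F (f xs)"] ext_nth[of 0 "y # p"]
    by (simp_all add: f'_def hreal_def)
  have "eventually (\<lambda>xs. [Real (f' xs), xs ! 0] \<in> {[Real r, Real (F r)] | r. True}) (type_filter (y # p))"
    using y unfolding q by (subst (asm) y') (simp add: Los2)
  then show "y = hreal p (\<lambda>xs. F (f xs))"
    unfolding q2 by (subst y') (auto simp: ext_eq_iff elim!: eventually_mono)
qed

lemma hfun2_hreal: "hfun2 F (hreal p f) (hreal p g) = hreal p (\<lambda>xs. F (f xs) (g xs))"
  unfolding hfun2_def
proof (rule the_equality)
  show "[hreal p f, hreal p g, hreal p (\<lambda>xs. F (f xs) (g xs))]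
      \<in> star {[Real r, Real s, Real (F r s)] | r s. True}"
    by (simp add: hreal_def Los3)
next
  fix y assume y: "[hreal p f, hreal p g, y] \<in> star {[Real r, Real s, Real (F r s)] | r s. True}"
  define f' g' where "f' = (\<lambda>xs. f (tl xs))" and "g' = (\<lambda>xs. g (tl xs))"
  have q: "hreal p f = ext (y # p) (\<lambda>xs. Real (f' xs))"
      "hreal p g = ext (y # p) (\<lambda>xs. Real (g' xs))"
    and y': "y = ext (y # p) (\<lambda>xs. xs ! 0)"
    and q2: "hreal p (\<lambda>xs. F (f xs) (g xs)) = ext (y # p) (\<lambda>xs. Real (F (f' xs) (g' xs)))"
    using hreal_Cons[of y p f] hreal_Cons[of y p g] hreal_Cons[of y p "\<lambda>xs. F (f xs) (g xs)"]
      ext_nth[of 0 "y # p"]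
    by (simp_all add: f'_def g'_def hreal_def)
  have "eventually (\<lambda>xs. [Real (f' xs), Real (g' xs), xs ! 0] \<in> {[Real r, Real s, Real (F r s)] | r s. True})
      (type_filter (y # p))"
    using y unfolding q by (subst (asm) y') (simp add: Los3)
  then show "y = hreal p (\<lambda>xs. F (f xs) (g xs))"
    unfolding q2 by (subst y') (auto simp: ext_eq_iff elim!: eventually_mono)
qed

lemma hadd_hreal: "hreal p f +\<^sub>\<star> hreal p g = hreal p (\<lambda>xs. f xs + g xs)"
  by (simp add: hadd_def hfun2_hreal)

lemma hdist_hreal: "hdist (hreal p f) (hreal p g) = hreal p (\<lambda>xs. \<bar>f xs - g xs\<bar>)"
  by (simp add: hdist_def hfun2_hreal)

lemma hroot_hreal: "hroot m (hreal p f) = hreal p (\<lambda>xs. root m (f xs))"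
  by (simp add: hroot_def hfun1_hreal)

lemma hceiling_hreal: "hceiling (hreal p f) = hreal p (\<lambda>xs. of_int \<lceil>f xs\<rceil>)"
  by (simp add: hceiling_def hfun1_hreal)

lemma hpower_hreal: "hpower (hreal p f) m = hreal p (\<lambda>xs. f xs ^ m)"
  by (simp add: hpower_def hfun1_hreal)

section \<open>Hypernaturals, internal sets and internal sums\<close>

definition pos_nats :: "real set" where
  "pos_nats = {real n | n. n \<ge> 1}"

lemma hnats_hreal: "hreal p f \<in> hnats \<longleftrightarrow> eventually (\<lambda>xs. f xs \<in> pos_nats) (type_filter p)"
  by (auto simp: hnats_def hreal_def Los1 pos_nats_def)

lemma hnats_subset: "hnats \<subseteq> hreals"
  unfolding hnats_def hreals_def by (auto elim!: star_mono[rotated])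

lemma hset_subset: "hset s \<subseteq> hreals"
proof
  fix x assume "x \<in> hset s"
  then have "map ((!) [x, s]) [0, 1] \<in> star {[Real r, RSet B] | r B. r \<in> B}"
    by (simp add: hset_def)
  then have "[x, s] \<in> star {xs. map ((!) xs) [0] \<in> {[Real r] | r. True}}"
    by (subst (asm) star_reindex) (auto elim!: star_mono[rotated])
  then show "x \<in> hreals"
    using star_reindex[of "[0]" "[x, s]"] by (simp add: hreals_def)
qed

lemma mem_hset_hreal: "hreal p f \<in> hset (hcode p S) \<longleftrightarrow> eventually (\<lambda>xs. f xs \<in> S xs) (type_filter p)"
  by (simp add: hset_def hreal_def hcode_def Los2)

text \<open>From left to right, a pointwise choice of counterexamples would define a hyperreal in
  one set but not in the other. Conversely, an arbitrary element is adjoined to the tuple.\<close>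

lemma hset_hcode_subset_iff:
  "hset (hcode p S) \<subseteq> hset (hcode p T) \<longleftrightarrow> eventually (\<lambda>xs. S xs \<subseteq> T xs) (type_filter p)"
proof
  assume sub: "hset (hcode p S) \<subseteq> hset (hcode p T)"
  show "eventually (\<lambda>xs. S xs \<subseteq> T xs) (type_filter p)"
  proof (rule ccontr)
    assume "\<not> eventually (\<lambda>xs. S xs \<subseteq> T xs) (type_filter p)"
    then have *: "eventually (\<lambda>xs. \<not> S xs \<subseteq> T xs) (type_filter p)" by (simp add: type_filter_ultra)
    define f where "f = (\<lambda>xs. SOME r. r \<in> S xs - T xs)"
    have "eventually (\<lambda>xs. f xs \<in> S xs - T xs) (type_filter p)"
      using * unfolding f_def by eventually_elim (rule someI_ex, auto)
    then have "hreal p f \<in> hset (hcode p S)" "\<not> hreal p f \<in> hset (hcode p T)"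
      by (auto simp: mem_hset_hreal simp flip: type_filter_ultra elim!: eventually_mono)
    then show False using sub by blast
  qed
next
  assume ev: "eventually (\<lambda>xs. S xs \<subseteq> T xs) (type_filter p)"
  show "hset (hcode p S) \<subseteq> hset (hcode p T)"
  proof
    fix x assume x: "x \<in> hset (hcode p S)"
    then have xr: "x = hreal (x # p) (\<lambda>xs. real_of_univ (hd xs))"
      using hset_subset by (intro represent_Cons) auto
    \<comment> \<open>Inclusion is written as an equation between codes, since equations of values
      persist when the tuple is enlarged.\<close>
    have "hcode (x # p) (\<lambda>xs. S (tl xs)) = hcode (x # p) (\<lambda>xs. (S (tl xs)) \<inter> T (tl xs))"
      using ev hcode_Cons[of x p S] hcode_Cons[of x p "\<lambda>xs. S xs \<inter> T xs"]
      by (auto simp: hcode_eq_iff elim!: eventually_mono)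
    then have ev': "eventually (\<lambda>xs. S (tl xs) \<subseteq> T (tl xs)) (type_filter (x # p))"
      by (auto simp: hcode_eq_iff elim!: eventually_mono)
    have "hreal (x # p) (\<lambda>xs. real_of_univ (hd xs)) \<in> hset (hcode (x # p) (\<lambda>xs. S (tl xs)))"
      using x xr by (simp add: hcode_Cons)
    then have "hreal (x # p) (\<lambda>xs. real_of_univ (hd xs)) \<in> hset (hcode (x # p) (\<lambda>xs. T (tl xs)))"
      unfolding mem_hset_hreal using ev' by eventually_elim auto
    then show "x \<in> hset (hcode p T)" using xr by (simp add: hcode_Cons)
  qed
qed

lemma hset_hcode_eq_iff:
  "hset (hcode p S) = hset (hcode p T) \<longleftrightarrow> hcode p S = hcode p T"
proof -
  have "hset (hcode p S) = hset (hcode p T) \<longleftrightarrow>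
      hset (hcode p S) \<subseteq> hset (hcode p T) \<and> hset (hcode p T) \<subseteq> hset (hcode p S)" by blast
  also have "\<dots> \<longleftrightarrow> hcode p S = hcode p T"
    unfolding hset_hcode_subset_iff hcode_eq_iff by (simp add: set_eq_subset eventually_conj_iff)
  finally show ?thesis .
qed

text \<open>Extensionality for codes: choosing a code for an internal set, as in
  \<open>hsum\<close>, leaves only one candidate.\<close>

lemma hset_inject:
  assumes "s \<in> hcodes" "t \<in> hcodes" "hset s = hset t"
  shows "s = t"
proof -
  obtain p fs Ss where "[] = map (hreal p) fs" "[s, t] = map (hcode p) Ss"
    using represent[of "[]" "[s, t]"] assms by auto
  then show ?thesis using assms(3) hset_hcode_eq_iff by (auto simp: Cons_eq_map_conv)
qed

lemma internal_iff: "internal A \<longleftrightarrow> (\<exists>s\<in>hcodes. A = hset s)"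
  by (auto simp: internal_def hcodes_def)

lemma internal_hset_hcode [simp]: "internal (hset (hcode p S))"
  by (auto simp: internal_iff)

text \<open>An element of the extension need not be a value over \<open>p\<close>, so it is adjoined to the tuple.\<close>

lemma mem_hset_iff:
  "x \<in> hset (hcode p S) \<longleftrightarrow> x \<in> hreals \<and>
     eventually (\<lambda>xs. real_of_univ (hd xs) \<in> S (tl xs)) (type_filter (x # p))"
proof (cases "x \<in> hreals")
  case True
  then show ?thesis
    using mem_hset_hreal[of "x # p" "\<lambda>xs. real_of_univ (hd xs)" "\<lambda>xs. S (tl xs)"]
      represent_Cons[OF True, of p] by (simp add: hcode_Cons)
qed (use hset_subset in auto)

lemma hset_Un: "hset (hcode p S) \<union> hset (hcode p T) = hset (hcode p (\<lambda>xs. S xs \<union> T xs))"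
proof -
  \<comment> \<open>Ultrafilters are prime; this is what lets unions be formed pointwise.\<close>
  have "eventually (\<lambda>xs. P xs \<or> Q xs) (type_filter q) \<longleftrightarrow>
      eventually P (type_filter q) \<or> eventually Q (type_filter q)" for P Q and q :: "'a list"
    using type_filter_ultra[of P q] type_filter_ultra[of Q q] type_filter_ultra[of "\<lambda>xs. P xs \<or> Q xs" q]
    by (auto simp: eventually_conj_iff)
  then show ?thesis by (auto simp: mem_hset_iff)
qed

lemma hset_Int: "hset (hcode p S) \<inter> hset (hcode p T) = hset (hcode p (\<lambda>xs. S xs \<inter> T xs))"
  by (auto simp: mem_hset_iff eventually_conj_iff)

lemma hset_Diff: "hset (hcode p S) - hset (hcode p T) = hset (hcode p (\<lambda>xs. S xs - T xs))"
  by (auto simp: mem_hset_iff eventually_conj_iff type_filter_ultra)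

lemma hset_empty: "hset (hcode p (\<lambda>_. {})) = {}"
  by (auto simp: mem_hset_iff)

text \<open>Extensionality fixes the code in the \<open>THE\<close>, and the candidate sum is
  adjoined to the tuple to be compared with the pointwise sum.\<close>

lemma hsum_hcode: "hsum f (hset (hcode p S)) = hreal p (\<lambda>xs. \<Sum>a\<in>S xs. f a)"
  unfolding hsum_def
proof (rule the_equality)
  show "\<exists>s. hset (hcode p S) = hset s \<and>
      [s, hreal p (\<lambda>xs. \<Sum>a\<in>S xs. f a)] \<in> star {[RSet B, Real (\<Sum>a\<in>B. f a)] | B. True}"
    by (intro exI[of _ "hcode p S"]) (simp add: hreal_def hcode_def Los2)
next
  fix y
  assume "\<exists>s. hset (hcode p S) = hset s \<and> [s, y] \<in> star {[RSet B, Real (\<Sum>a\<in>B. f a)] | B. True}"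
  then obtain s where s: "hset (hcode p S) = hset s"
    and sy: "[s, y] \<in> star {[RSet B, Real (\<Sum>a\<in>B. f a)] | B. True}" by blast
  have "map ((!) [s, y]) [0] \<in> star {[RSet B] | B. True}"
    using sy by (subst star_reindex) (auto elim!: star_mono[rotated])
  then have "s \<in> hcodes" by (simp add: hcodes_def)
  then have "s = hcode p S" using s by (intro hset_inject) simp_all
  define S' where "S' = (\<lambda>xs. S (tl xs))"
  have q: "hcode p S = ext (y # p) (\<lambda>xs. RSet (S' xs))"
    and y': "y = ext (y # p) (\<lambda>xs. xs ! 0)"
    and q2: "hreal p (\<lambda>xs. \<Sum>a\<in>S xs. f a) = ext (y # p) (\<lambda>xs. Real (\<Sum>a\<in>S' xs. f a))"
    using hreal_Cons[of y p "\<lambda>xs. \<Sum>a\<in>S xs. f a"] hcode_Cons[of y p S] ext_nth[of 0 "y # p"]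
    by (simp_all add: S'_def hreal_def hcode_def)
  have "eventually (\<lambda>xs. [RSet (S' xs), xs ! 0] \<in> {[RSet B, Real (\<Sum>a\<in>B. f a)] | B. True})
      (type_filter (y # p))"
    using sy unfolding \<open>s = hcode p S\<close> q by (subst (asm) y') (simp add: Los2)
  then show "y = hreal p (\<lambda>xs. \<Sum>a\<in>S xs. f a)"
    unfolding q2 by (subst y') (auto simp: ext_eq_iff elim!: eventually_mono)
qed

section \<open>Standard parts as limits along the ultrafilter\<close>

lemma st_hreal_eqI:
  assumes "(f \<longlongrightarrow> r) (type_filter p)"
  shows "st (hreal p f) = r"
  unfolding st_def
proof (rule the_equality)
  have dist: "hdist (hreal p f) (std (Real s)) <\<^sub>\<star> std (Real e) \<longleftrightarrow>
      eventually (\<lambda>xs. \<bar>f xs - s\<bar> < e) (type_filter p)" for s e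
    using hdist_hreal[of p f "\<lambda>_. s"] hless_hreal[of p _ "\<lambda>_. e"] by simp
  show "\<forall>e>0. hdist (hreal p f) (std (Real r)) <\<^sub>\<star> std (Real e)"
    using assms by (auto simp: dist tendsto_iff dist_real_def)
  fix s assume "\<forall>e>0. hdist (hreal p f) (std (Real s)) <\<^sub>\<star> std (Real e)"
  then have "(f \<longlongrightarrow> s) (type_filter p)" by (auto simp: dist tendsto_iff dist_real_def)
  then show "s = r" using assms by (intro tendsto_unique[of "type_filter p"]) auto
qed

text \<open>Compactness yields a cluster point of the image filter, and for an ultrafilter a cluster
  point is a limit. This guarantees that bounded quantities have standard parts.\<close>

lemma bounded_tendsto_type_filter:
  fixes f :: "univ list \<Rightarrow> real"
  assumes "eventually (\<lambda>xs. \<bar>f xs\<bar> \<le> C) (type_filter p)"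
  obtains r where "(f \<longlongrightarrow> r) (type_filter p)"
proof -
  let ?F = "filtermap f (type_filter p)"
  have "compact {-C..C}" by simp
  moreover have "?F \<noteq> bot" by (simp add: filtermap_bot_iff)
  moreover have "eventually (\<lambda>y. y \<in> {-C..C}) ?F"
    using assms by (auto simp: eventually_filtermap abs_le_iff elim!: eventually_mono)
  ultimately obtain r where r: "inf (nhds r) ?F \<noteq> bot"
    unfolding compact_filter by blast
  have "eventually (\<lambda>xs. f xs \<in> V) (type_filter p)" if "open V" "r \<in> V" for V
  proof (rule ccontr)
    assume "\<not> eventually (\<lambda>xs. f xs \<in> V) (type_filter p)"
    then have "eventually (\<lambda>y. y \<notin> V) ?F" by (simp add: eventually_filtermap type_filter_ultra)
    moreover have "eventually (\<lambda>y. y \<in> V) (nhds r)" using that by (rule eventually_nhds_in_open)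
    ultimately have "eventually (\<lambda>_. False) (inf (nhds r) ?F)"
      unfolding eventually_inf by (metis (mono_tags, lifting))
    then show False using r by (simp add: eventually_False)
  qed
  then have "(f \<longlongrightarrow> r) (type_filter p)" by (auto simp: tendsto_def)
  then show thesis by (rule that)
qed

section \<open>Weights and blocks of the standard power interval\<close>

text \<open>For positive \<open>a\<close> this is \<open>m\<close> times the derivative of the
  \<open>m\<close>-th root, hence its comparison with \<open>m * root_increment m a\<close>.\<close>

definition weight :: "nat \<Rightarrow> real \<Rightarrow> real" where
  "weight m a = a powr (- ((real m - 1) / real m))"

definition root_increment :: "nat \<Rightarrow> real \<Rightarrow> real" where
  "root_increment m a = root m a - root m (a - 1)"

definition root_ceiling :: "nat \<Rightarrow> real \<Rightarrow> int" where
  "root_ceiling m a = \<lceil>root m a\<rceil>"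

definition std_interval :: "nat \<Rightarrow> real \<Rightarrow> real \<Rightarrow> real set" where
  "std_interval m k N = {x \<in> pos_nats. k \<le> x \<and> x \<le> (of_int (root_ceiling m k) + N) ^ m}"

text \<open>A block consists of the points of the interval sharing a \<open>root_ceiling\<close>;
  the saturated sets are the unions of blocks.\<close>

definition saturated :: "nat \<Rightarrow> real \<Rightarrow> real \<Rightarrow> real set \<Rightarrow> bool" where
  "saturated m k N D \<longleftrightarrow> D \<subseteq> std_interval m k N \<and>
     (\<forall>a\<in>std_interval m k N. \<forall>d\<in>D. root_ceiling m a = root_ceiling m d \<longrightarrow> a \<in> D)"

definition shift_preimage :: "nat \<Rightarrow> real \<Rightarrow> real \<Rightarrow> real \<Rightarrow> real set \<Rightarrow> real set" where
  "shift_preimage m k N c D = {a \<in> std_interval m k N. (of_int (root_ceiling m a) + c) ^ m \<in> D}"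

lemma weight_nonneg [simp]: "weight m a \<ge> 0"
  by (simp add: weight_def)

section \<open>Weights compared with root increments\<close>

lemma weight_eq_root:
  assumes "m \<ge> 1" "a > 0"
  shows "weight m a = 1 / root m a ^ (m - 1)"
proof -
  have "weight m a = 1 / a powr ((real m - 1) / real m)"
    by (simp add: weight_def powr_minus_divide)
  also have "a powr ((real m - 1) / real m) = (a powr (1 / real m)) powr real (m - 1)"
    using assms by (simp add: powr_powr of_nat_diff)
  also have "\<dots> = root m a ^ (m - 1)"
    using assms by (simp add: root_powr_inverse powr_realpow del: of_nat_diff)
  finally show ?thesis .
qed

text \<open>In the factorization of \<open>x ^ Suc n - y ^ Suc n\<close> each of the
  \<open>Suc n\<close> summands lies between \<open>y ^ n\<close> and \<open>x ^ n\<close>, a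
  discrete mean value estimate.\<close>

lemma power_diff_bounds:
  fixes x y :: real
  assumes "0 \<le> y" "y \<le> x"
  shows "x ^ Suc n - y ^ Suc n \<le> (x - y) * (real (Suc n) * x ^ n)"
    and "(x - y) * (real (Suc n) * y ^ n) \<le> x ^ Suc n - y ^ Suc n"
proof -
  have eq: "x ^ Suc n - y ^ Suc n = (x - y) * (\<Sum>i<Suc n. x ^ i * y ^ (n - i))"
    using diff_power_eq_sum[of x n y] by simp
  have b: "y ^ n \<le> x ^ i * y ^ (n - i)" "x ^ i * y ^ (n - i) \<le> x ^ n" if "i < Suc n" for i
  proof -
    have "y ^ n = y ^ i * y ^ (n - i)" "x ^ n = x ^ i * x ^ (n - i)"
      using that by (simp_all flip: power_add)
    then show "y ^ n \<le> x ^ i * y ^ (n - i)" "x ^ i * y ^ (n - i) \<le> x ^ n"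
      using assms by (auto intro!: mult_mono power_mono)
  qed
  have "(\<Sum>i<Suc n. x ^ i * y ^ (n - i)) \<le> (\<Sum>i<Suc n. x ^ n)"
    using b(2) by (intro sum_mono) blast
  then show "x ^ Suc n - y ^ Suc n \<le> (x - y) * (real (Suc n) * x ^ n)"
    unfolding eq using assms by (intro mult_left_mono) auto
  have "(\<Sum>i<Suc n. y ^ n) \<le> (\<Sum>i<Suc n. x ^ i * y ^ (n - i))"
    using b(1) by (intro sum_mono) blast
  then show "(x - y) * (real (Suc n) * y ^ n) \<le> x ^ Suc n - y ^ Suc n"
    unfolding eq using assms by (intro mult_left_mono) auto
qed

text \<open>The numbers \<open>root m a\<close> and \<open>root m (a - 1)\<close> have
  \<open>m\<close>-th powers differing by 1; the upper estimate for this difference is divided by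
  the power of \<open>root m a\<close>.\<close>

lemma weight_le_increment:
  assumes "m \<ge> 1" "a \<ge> 1"
  shows "weight m a \<le> real m * root_increment m a"
proof -
  obtain n where m: "m = Suc n" using assms by (cases m) auto
  let ?x = "root m a" and ?y = "root m (a - 1)"
  have x: "?x > 0" and y: "?y \<ge> 0" "?y \<le> ?x" using assms by auto
  have "1 = ?x ^ Suc n - ?y ^ Suc n"
    using assms real_root_pow_pos2[of m a] real_root_pow_pos2[of m "a - 1"] m by simp
  also have "\<dots> \<le> (?x - ?y) * (real (Suc n) * ?x ^ n)"
    using power_diff_bounds(1)[OF y] .
  finally have "1 \<le> (real m * root_increment m a) * ?x ^ n"
    by (simp add: m root_increment_def mult_ac)
  then show ?thesis
    using x assms by (simp add: weight_eq_root m pos_divide_le_eq)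
qed

text \<open>The lower estimate is divided by the power of \<open>root m (a - 1)\<close>, which is
  positive because \<open>a > 1\<close>.\<close>

lemma increment_le_weight:
  assumes "m \<ge> 1" "a > 1"
  shows "real m * root_increment m a \<le> weight m (a - 1)"
proof -
  obtain n where m: "m = Suc n" using assms by (cases m) auto
  let ?x = "root m a" and ?y = "root m (a - 1)"
  have x: "?y > 0" and y: "?y \<ge> 0" "?y \<le> ?x" using assms by auto
  have "(?x - ?y) * (real (Suc n) * ?y ^ n) \<le> ?x ^ Suc n - ?y ^ Suc n"
    using power_diff_bounds(2)[OF y] .
  also have "\<dots> = 1"
    using assms real_root_pow_pos2[of m a] real_root_pow_pos2[of m "a - 1"] m by simp
  finally have "(real m * root_increment m a) * ?y ^ n \<le> 1"
    by (simp add: m root_increment_def mult_ac)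
  then show ?thesis
    using x assms by (simp add: weight_eq_root m pos_le_divide_eq)
qed

lemma sum_increment_minus_weight:
  assumes m: "m \<ge> 1" and A: "finite A" "A \<subseteq> pos_nats"
  shows "0 \<le> (\<Sum>a\<in>A. real m * root_increment m a - weight m a)"
    and "(\<Sum>a\<in>A. real m * root_increment m a - weight m a) \<le> real m"
proof -
  let ?d = "\<lambda>a. real m * root_increment m a - weight m a"
  have d: "?d a \<ge> 0" if "a \<in> pos_nats" for a
    using weight_le_increment[OF m, of a] that by (auto simp: pos_nats_def)
  show "0 \<le> sum ?d A" using d A by (intro sum_nonneg) auto
  \<comment> \<open>The first term is \<open>m - weight m 1\<close>, since the root increases by 1
    from 0 to 1; each later term is at most a difference of consecutive weights.\<close>
  have telescope: "(\<Sum>n=1..Suc M. ?d (real n)) \<le> real m - weight m (real (Suc M))" for M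
  proof (induction M)
    case 0
    then show ?case using m by (simp add: root_increment_def)
  next
    case (Suc M)
    have "real m * root_increment m (real (Suc (Suc M))) \<le> weight m (real (Suc M))"
      using increment_le_weight[OF m, of "real (Suc (Suc M))"] by simp
    then show ?case using Suc.IH by simp
  qed
  \<comment> \<open>Seen as a set of natural numbers, \<open>A\<close> can be enlarged to an initial
    segment because all terms are nonnegative.\<close>
  define B where "B = {n. n \<ge> 1 \<and> real n \<in> A}"
  have B: "A = real ` B" "B \<subseteq> {1..}"
    using A(2) by (force simp: pos_nats_def B_def)+
  have "finite B" using A(1) B(1) by (simp add: finite_image_iff inj_on_def)
  then obtain M where M: "B \<subseteq> {..M}" by (meson finite_nat_iff_bounded_le)
  have "sum ?d A = (\<Sum>n\<in>B. ?d (real n))"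
    unfolding B(1) by (subst sum.reindex) (auto simp: inj_on_def)
  also have "\<dots> \<le> (\<Sum>n=1..Suc M. ?d (real n))"
  proof (rule sum_mono2)
    show "?d (real b) \<ge> 0" if "b \<in> {1..Suc M} - B" for b
      using that by (intro d) (auto simp: pos_nats_def)
  qed (use M B(2) in force)+
  also have "\<dots> \<le> real m" using telescope[of M] weight_nonneg[of m "real (Suc M)"] by linarith
  finally show "sum ?d A \<le> real m" .
qed

section \<open>Finiteness of the interval and block indices\<close>

lemma finite_bounded_pos_nats: "finite {x \<in> pos_nats. x \<le> b}"
proof -
  have "{x \<in> pos_nats. x \<le> b} \<subseteq> real ` {..nat \<lfloor>b\<rfloor>}"
    by (auto simp: pos_nats_def le_nat_floor)
  then show ?thesis by (rule finite_subset) simp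
qed

lemma finite_std_interval [simp]: "finite (std_interval m k N)"
  by (rule finite_subset[OF _ finite_bounded_pos_nats[of "(of_int (root_ceiling m k) + N) ^ m"]])
     (auto simp: std_interval_def)

text \<open>By monotonicity of roots, comparing the index of a point with \<open>j\<close> amounts
  to comparing the point with \<open>j ^ m\<close>; blocks are thus cut out by consecutive
  \<open>m\<close>-th powers.\<close>

lemma root_ceiling_le_iff:
  assumes "m \<ge> 1" "a \<ge> 0" "j \<ge> 0"
  shows "root_ceiling m a \<le> j \<longleftrightarrow> a \<le> of_int j ^ m"
proof -
  have "root_ceiling m a \<le> j \<longleftrightarrow> root m a \<le> of_int j" by (simp add: root_ceiling_def ceiling_le_iff)
  also have "\<dots> \<longleftrightarrow> root m a \<le> root m (of_int j ^ m)"
    using assms by (simp add: real_root_power_cancel)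
  also have "\<dots> \<longleftrightarrow> a \<le> of_int j ^ m" using assms by simp
  finally show ?thesis .
qed

lemma root_ceiling_mono: "m \<ge> 1 \<Longrightarrow> a \<le> b \<Longrightarrow> root_ceiling m a \<le> root_ceiling m b"
  by (simp add: root_ceiling_def ceiling_mono)

lemma root_ceiling_power [simp]: "m \<ge> 1 \<Longrightarrow> j \<ge> 0 \<Longrightarrow> root_ceiling m (of_int j ^ m) = j"
  by (simp add: root_ceiling_def real_root_power_cancel)

lemma root_ceiling_pos: "m \<ge> 1 \<Longrightarrow> a \<ge> 1 \<Longrightarrow> root_ceiling m a \<ge> 1"
  using root_ceiling_mono[of m 1 a] by (simp add: root_ceiling_def)

lemma pos_nats_int: "x \<in> pos_nats \<Longrightarrow> \<exists>i::int. i \<ge> 1 \<and> x = of_int i"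
proof -
  assume "x \<in> pos_nats"
  then obtain n where "x = real n" "n \<ge> 1" by (auto simp: pos_nats_def)
  then show ?thesis by (intro exI[of _ "int n"]) auto
qed

lemma of_int_in_pos_nats: "i \<ge> 1 \<Longrightarrow> real_of_int i \<in> pos_nats"
  by (auto simp: pos_nats_def intro!: exI[of _ "nat i"])

section \<open>Counting the blocks of a standard interval\<close>

context
  fixes m :: nat and k N :: real and K n :: int
  assumes m: "m \<ge> 1" and k: "k \<in> pos_nats" and N: "N = of_int n" "n \<ge> 1"
  defines "K \<equiv> root_ceiling m k"
begin

text \<open>The right endpoint is the \<open>m\<close>-th power of \<open>K + n\<close>, thus the
  end of block \<open>K + n\<close>; only the first block can be incomplete.\<close>

lemma mem_std_interval_iff:
  "a \<in> std_interval m k N \<longleftrightarrow> a \<in> pos_nats \<and> k \<le> a \<and> root_ceiling m a \<le> K + n"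
proof -
  have K: "K \<ge> 1" using root_ceiling_pos[OF m, of k] k by (auto simp: K_def pos_nats_def)
  have "a \<le> (of_int K + N) ^ m \<longleftrightarrow> root_ceiling m a \<le> K + n" if "a \<in> pos_nats"
    using root_ceiling_le_iff[OF m, of a "K + n"] that K N by (auto simp: pos_nats_def)
  then show ?thesis by (auto simp: std_interval_def K_def)
qed

lemma power_mem_std_interval_iff:
  assumes "j \<ge> K"
  shows "of_int j ^ m \<in> std_interval m k N \<longleftrightarrow> j \<le> K + n"
proof -
  have K: "K \<ge> 1" using root_ceiling_pos[OF m, of k] k by (auto simp: K_def pos_nats_def)
  then have "real_of_int j ^ m \<in> pos_nats"
    using of_int_in_pos_nats[of "j ^ m"] assms by simp
  moreover have "k \<le> of_int j ^ m"
    using root_ceiling_le_iff[OF m, of k j] K k assms by (auto simp: pos_nats_def K_def)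
  ultimately show ?thesis using m K assms by (simp add: mem_std_interval_iff)
qed

lemma root_ceiling_std_interval:
  "a \<in> std_interval m k N \<Longrightarrow> root_ceiling m a \<in> {K..K + n}"
  using root_ceiling_mono[OF m, of k a] by (auto simp: mem_std_interval_iff K_def)

text \<open>Block \<open>j\<close> contains its right end \<open>j ^ m\<close>, so a union of blocks
  includes block \<open>j\<close> exactly when it contains that point.\<close>

lemma root_ceiling_image:
  assumes "saturated m k N D" 
  shows "root_ceiling m ` D = {j \<in> {K..K + n}. of_int j ^ m \<in> D}"
proof -
  have K: "K \<ge> 1" using root_ceiling_pos[OF m, of k] k by (auto simp: K_def pos_nats_def)
  show ?thesis
  proof (intro equalityI subsetI)
    fix j assume "j \<in> root_ceiling m ` D"
    then obtain a where a: "a \<in> D" "j = root_ceiling m a" by auto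
    then have j: "j \<in> {K..K + n}" using assms root_ceiling_std_interval by (auto simp: saturated_def)
    then have "of_int j ^ m \<in> std_interval m k N" using power_mem_std_interval_iff by auto
    moreover have "root_ceiling m (of_int j ^ m) = root_ceiling m a" using a j K m by simp
    ultimately show "j \<in> {j \<in> {K..K + n}. of_int j ^ m \<in> D}"
      using assms a(1) j unfolding saturated_def by blast
  next
    fix j assume "j \<in> {j \<in> {K..K + n}. of_int j ^ m \<in> D}"
    then show "j \<in> root_ceiling m ` D"
      using K m by (auto intro!: image_eqI[of _ _ "of_int j ^ m"])
  qed
qed

lemma sum_root_increment_nat:
  "a \<le> b \<Longrightarrow> (\<Sum>i=Suc a..b. root_increment m (real i)) = root m (real b) - root m (real a)"
  by (induction b rule: dec_induct) (auto simp: root_increment_def)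

text \<open>Increments telescope over a block, from the root of the natural number before it up to
  \<open>j\<close>; the starting root is \<open>j - 1\<close> unless the interval begins inside the
  block.\<close>

lemma sum_root_increment_block:
  assumes j: "j \<in> {K..K + n}"
  shows "(\<Sum>a | a \<in> std_interval m k N \<and> root_ceiling m a = j. root_increment m a) \<le> 1"
    and "j \<noteq> K \<Longrightarrow> (\<Sum>a | a \<in> std_interval m k N \<and> root_ceiling m a = j. root_increment m a) = 1"
    and "0 \<le> (\<Sum>a | a \<in> std_interval m k N \<and> root_ceiling m a = j. root_increment m a)"
proof -
  have K: "K \<ge> 1" using root_ceiling_pos[OF m, of k] k by (auto simp: K_def pos_nats_def)
  define i where "i = nat j"
  have i: "i \<ge> 1" "j = int i" using j K by (auto simp: i_def)
  obtain l where l: "k = real (Suc l)" using k by (auto simp: pos_nats_def dest: Suc_le_D)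
  \<comment> \<open>The natural number just before the block: the previous \<open>m\<close>-th
    power, or \<open>k - 1\<close> when the interval starts later.\<close>
  define b where "b = max l ((i - 1) ^ m)"
  have rc: "root_ceiling m (real a) = j \<longleftrightarrow> (i - 1) ^ m < a \<and> a \<le> i ^ m" for a
  proof -
    have 1: "root_ceiling m (real a) \<le> j \<longleftrightarrow> a \<le> i ^ m"
      using root_ceiling_le_iff[OF m, of "real a" j] i by (simp flip: of_nat_power)
    have "j - 1 = int (i - 1)" using i by simp
    then have "root_ceiling m (real a) \<le> j - 1 \<longleftrightarrow> a \<le> (i - 1) ^ m"
      using root_ceiling_le_iff[OF m, of "real a" "int (i - 1)"] by (simp del: of_nat_diff flip: of_nat_power)
    then show ?thesis using 1 by linarith
  qed
  have block: "{a. a \<in> std_interval m k N \<and> root_ceiling m a = j} = real ` {Suc b..i ^ m}"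
  proof (intro equalityI subsetI)
    fix a assume "a \<in> {a. a \<in> std_interval m k N \<and> root_ceiling m a = j}"
    then obtain a' where "a = real a'" "k \<le> real a'" "root_ceiling m (real a') = j"
      by (auto simp: mem_std_interval_iff pos_nats_def)
    then show "a \<in> real ` {Suc b..i ^ m}" by (auto simp: rc l b_def)
  next
    fix a assume "a \<in> real ` {Suc b..i ^ m}"
    then obtain a' where a': "a = real a'" "Suc b \<le> a'" "a' \<le> i ^ m" by auto
    then have "a \<in> pos_nats" "k \<le> a" "root_ceiling m a = j"
      using rc[of a'] l by (auto simp: b_def pos_nats_def)
    then show "a \<in> {a. a \<in> std_interval m k N \<and> root_ceiling m a = j}"
      using j by (simp add: mem_std_interval_iff)
  qed
  have "root_ceiling m k \<le> j" using j by (simp add: K_def)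
  then have "Suc l \<le> i ^ m"
    using root_ceiling_le_iff[OF m, of k j] i k by (simp add: l flip: of_nat_power)
  moreover have "(i - 1) ^ m < i ^ m" using i m by (intro power_strict_mono) auto
  ultimately have bi: "b \<le> i ^ m" by (simp add: b_def)
  have sum: "(\<Sum>a | a \<in> std_interval m k N \<and> root_ceiling m a = j. root_increment m a)
      = real i - root m (real b)"
    unfolding block using sum_root_increment_nat[OF bi] m
    by (subst sum.reindex) (auto simp: real_root_power_cancel)
  have "root m (real ((i - 1) ^ m)) \<le> root m (real b)"
    using m by (subst real_root_le_iff) (auto simp: b_def)
  then have "real (i - 1) \<le> root m (real b)" using m by (simp add: real_root_power_cancel)
  then show "(\<Sum>a | a \<in> std_interval m k N \<and> root_ceiling m a = j. root_increment m a) \<le> 1"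
    unfolding sum using i by (simp add: of_nat_diff)
  have "root m (real b) \<le> root m (real (i ^ m))"
    using bi m by (subst real_root_le_iff) auto
  then show "0 \<le> (\<Sum>a | a \<in> std_interval m k N \<and> root_ceiling m a = j. root_increment m a)"
    unfolding sum using m by (simp add: real_root_power_cancel)
  \<comment> \<open>Every later block lies wholly inside the interval, so its predecessor is exactly
    the power of \<open>i - 1\<close>.\<close>
  assume "j \<noteq> K"
  then have "\<not> root_ceiling m k \<ge> j" using j by (auto simp: K_def)
  then have "Suc l \<le> (i - 1) ^ m"
    using root_ceiling_le_iff[OF m, of k "int (i - 1)"] i k
    by (simp add: l not_le del: of_nat_diff flip: of_nat_power) linarith
  then have "b = (i - 1) ^ m" by (simp add: b_def)
  then show "(\<Sum>a | a \<in> std_interval m k N \<and> root_ceiling m a = j. root_increment m a) = 1"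
    unfolding sum using i m by (simp add: real_root_power_cancel of_nat_diff)
qed

text \<open>Up to a bounded error the weights are \<open>m\<close> times the increments, and these
  add up to \<open>m\<close> on each block but the first. Of the error \<open>2 * real m\<close>,
  one \<open>m\<close> pays for the replacement and one for an incomplete first block.\<close>

lemma sum_weight_saturated:
  assumes D: "saturated m k N D"
  shows "(\<Sum>a\<in>D. weight m a) \<le> real m * card (root_ceiling m ` D)"
    and "real m * card (root_ceiling m ` D) \<le> (\<Sum>a\<in>D. weight m a) + 2 * real m"
proof -
  let ?J = "root_ceiling m ` D"
  let ?blk = "\<lambda>j. \<Sum>a | a \<in> std_interval m k N \<and> root_ceiling m a = j. root_increment m a"
  have D': "D \<subseteq> std_interval m k N" using D by (simp add: saturated_def)
  have finD: "finite D" using D' finite_std_interval finite_subset by blast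
  have J: "?J \<subseteq> {K..K + n}" using D' root_ceiling_std_interval by auto
  have "(\<Sum>a\<in>D. root_increment m a) = (\<Sum>j\<in>?J. \<Sum>a | a \<in> D \<and> root_ceiling m a = j. root_increment m a)"
    using finD by (simp add: sum.image_gen[of D _ "root_ceiling m"])
  also have "\<dots> = (\<Sum>j\<in>?J. ?blk j)"
  proof (rule sum.cong[OF refl])
    fix j assume "j \<in> ?J"
    then have "{a. a \<in> D \<and> root_ceiling m a = j} = {a. a \<in> std_interval m k N \<and> root_ceiling m a = j}"
      using D by (force simp: saturated_def)
    then show "(\<Sum>a | a \<in> D \<and> root_ceiling m a = j. root_increment m a) = ?blk j" by simp
  qed
  finally have eq: "(\<Sum>a\<in>D. root_increment m a) = (\<Sum>j\<in>?J. ?blk j)" .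
  have "(\<Sum>j\<in>?J. ?blk j) \<le> (\<Sum>j\<in>?J. 1)"
    using J sum_root_increment_block(1) by (intro sum_mono) blast
  then have upper: "(\<Sum>a\<in>D. root_increment m a) \<le> card ?J" using eq by simp
  \<comment> \<open>Only block \<open>K\<close> can fall short of 1, and by at most 1.\<close>
  have "(\<Sum>j\<in>?J. 1 - ?blk j) \<le> (\<Sum>j\<in>?J. if j = K then 1 else 0)"
  proof (rule sum_mono)
    fix j assume "j \<in> ?J"
    then show "1 - ?blk j \<le> (if j = K then 1 else 0)"
      using J sum_root_increment_block(2,3)[of j] by auto
  qed
  also have "\<dots> \<le> 1" using finD by (simp add: sum.delta)
  finally have lower: "card ?J \<le> (\<Sum>a\<in>D. root_increment m a) + 1" using eq by (simp add: sum_subtractf)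
  have pn: "D \<subseteq> pos_nats" using D' by (auto simp: std_interval_def)
  have diff: "(\<Sum>a\<in>D. real m * root_increment m a - weight m a) =
      real m * (\<Sum>a\<in>D. root_increment m a) - (\<Sum>a\<in>D. weight m a)"
    by (simp add: sum_subtractf sum_distrib_left)
  note w = sum_increment_minus_weight[OF m finD pn, unfolded diff]
  have "real m * (\<Sum>a\<in>D. root_increment m a) \<le> real m * card ?J"
    using upper by (intro mult_left_mono) auto
  then show "(\<Sum>a\<in>D. weight m a) \<le> real m * card ?J" using w by linarith
  have "real m * card ?J \<le> real m * ((\<Sum>a\<in>D. root_increment m a) + 1)"
    using lower by (intro mult_left_mono) auto
  then show "real m * card ?J \<le> (\<Sum>a\<in>D. weight m a) + 2 * real m"
    using w by (simp add: distrib_left)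
qed

text \<open>The indices run from \<open>K\<close> to \<open>K + n\<close>, which allows at most
  \<open>n + 1\<close> blocks.\<close>

lemma sum_weight_std_interval: "(\<Sum>a\<in>std_interval m k N. weight m a) \<le> real m * (N + 1)"
proof -
  have sat: "saturated m k N (std_interval m k N)" by (simp add: saturated_def)
  have "card (root_ceiling m ` std_interval m k N) \<le> card {K..K + n}"
    using root_ceiling_std_interval by (intro card_mono) auto
  then have "real (card (root_ceiling m ` std_interval m k N)) \<le> N + 1" using N by auto
  then show ?thesis
    using sum_weight_saturated(1)[OF sat] mult_left_mono[of _ "N + 1" "real m"] by fastforce
qed

section \<open>Translating blocks by an integer\<close>

context
  fixes c :: real and c' :: int
  assumes c: "c = of_int c'" "c' \<ge> 1"
begin

lemma shift_mem_std_interval_iff: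
  assumes "a \<in> std_interval m k N"
  shows "(of_int (root_ceiling m a) + c) ^ m \<in> std_interval m k N \<longleftrightarrow> root_ceiling m a + c' \<le> K + n"
  using power_mem_std_interval_iff[of "root_ceiling m a + c'"] root_ceiling_std_interval[OF assms] c by simp

lemma saturated_shift_preimage: "saturated m k N (shift_preimage m k N c D)"
  by (auto simp: saturated_def shift_preimage_def)

text \<open>On indices the shift is translation by \<open>c'\<close>: the preimage has the indices
  of \<open>D\<close> moved down by \<open>c'\<close>, truncated to \<open>{K..K + n}\<close>. At
  most the \<open>c'\<close> lowest indices are lost, and the extra 2 is the error of
  \<open>sum_weight_saturated\<close>.\<close>

lemma sum_weight_shift_preimage:
  assumes D: "saturated m k N D"
  shows "\<bar>(\<Sum>a\<in>shift_preimage m k N c D. weight m a) - (\<Sum>a\<in>D. weight m a)\<bar> \<le> real m * (c + 2)"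
proof -
  let ?E = "shift_preimage m k N c D"
  let ?J = "root_ceiling m ` D" and ?J' = "root_ceiling m ` ?E"
  have K: "K \<ge> 1" using root_ceiling_pos[OF m, of k] k by (auto simp: K_def pos_nats_def)
  have fin: "finite ?J" "finite ?J'"
    using D finite_subset[OF _ finite_std_interval[of m k N]]
    by (auto simp: saturated_def shift_preimage_def)
  have J: "?J = {j \<in> {K..K + n}. of_int j ^ m \<in> D}" by (rule root_ceiling_image[OF D])
  have "?J' = {j \<in> {K..K + n}. of_int j ^ m \<in> ?E}"
    by (rule root_ceiling_image[OF saturated_shift_preimage])
  also have "\<dots> = {j \<in> {K..K + n}. of_int (j + c') ^ m \<in> D}"
    using power_mem_std_interval_iff m K c by (auto simp: shift_preimage_def)
  also have "\<dots> = {j \<in> {K..K + n}. j + c' \<in> ?J}"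
  proof -
    have "j + c' \<in> ?J \<longleftrightarrow> of_int (j + c') ^ m \<in> D" if "j \<in> {K..K + n}" for j
    proof -
      have "of_int (j + c') ^ m \<in> D \<Longrightarrow> j + c' \<le> K + n"
        using power_mem_std_interval_iff[of "j + c'"] D that c by (auto simp: saturated_def)
      then show ?thesis using that c unfolding J by auto
    qed
    then show ?thesis by auto
  qed
  finally have J': "?J' = {j \<in> {K..K + n}. j + c' \<in> ?J}" .
  have "card ?J' \<le> card ?J"
    using fin J' by (intro card_inj_on_le[of "\<lambda>j. j + c'"]) auto
  moreover have "card ?J \<le> card ?J' + nat c'"
  proof -
    \<comment> \<open>Indices below \<open>K + c'\<close> are those that leave the interval on the
      left when moved down.\<close>
    have "?J \<subseteq> (\<lambda>j. j + c') ` ?J' \<union> {K..<K + c'}"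
    proof
      fix j assume j: "j \<in> ?J"
      show "j \<in> (\<lambda>j. j + c') ` ?J' \<union> {K..<K + c'}"
      proof (cases "j < K + c'")
        case False
        then have "j - c' \<in> ?J'" using j c J J' by auto
        then show ?thesis by (auto intro: image_eqI[of _ _ "j - c'"])
      qed (use j J in auto)
    qed
    then have "card ?J \<le> card ((\<lambda>j. j + c') ` ?J' \<union> {K..<K + c'})"
      using fin by (intro card_mono) auto
    also have "\<dots> \<le> card ((\<lambda>j. j + c') ` ?J') + card {K..<K + c'}" by (rule card_Un_le)
    also have "\<dots> = card ?J' + nat c'" by (subst card_image) (auto simp: inj_on_def)
    finally show ?thesis .
  qed
  ultimately have "real (card ?J') \<le> card ?J" "real (card ?J) \<le> card ?J' + c" using c by linarith+
  then have "real m * card ?J' \<le> real m * card ?J" "real m * card ?J \<le> real m * (card ?J' + c)"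
    by (auto intro!: mult_left_mono simp del: of_nat_le_iff)
  then show ?thesis
    using sum_weight_saturated[OF D] sum_weight_saturated[OF saturated_shift_preimage, of D]
    by (auto simp: distrib_left abs_le_iff)
qed

text \<open>At most \<open>2 * c' + 1\<close> indices are concerned. The width leaves room for the
  shift, for a move by less than \<open>c\<close> inside a cut class, and for rounding;
  \<open>right_end_null\<close> uses all three.\<close>

lemma sum_weight_right_end:
  "(\<Sum>a | a \<in> std_interval m k N \<and> of_int (root_ceiling m a) + 2 * c + 1 > of_int (root_ceiling m k) + N. weight m a)
     \<le> real m * (2 * c + 1)"
proof -
  let ?Z = "{a. a \<in> std_interval m k N \<and> of_int (root_ceiling m a) + 2 * c + 1 > of_int (root_ceiling m k) + N}"
  have sat: "saturated m k N ?Z" by (auto simp: saturated_def)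
  have "root_ceiling m ` ?Z \<subseteq> {K + n - 2 * c'.. K + n}"
  proof
    fix j assume "j \<in> root_ceiling m ` ?Z"
    then obtain a where a: "j = root_ceiling m a" "a \<in> std_interval m k N"
      "of_int K + N < of_int j + 2 * c + 1" by (auto simp: K_def)
    then have "K + n < j + 2 * c' + 1" using c N by linarith
    then show "j \<in> {K + n - 2 * c'.. K + n}" using root_ceiling_std_interval[OF a(2)] a(1) by auto
  qed
  then have "card (root_ceiling m ` ?Z) \<le> card {K + n - 2 * c'.. K + n}"
    by (intro card_mono) auto
  then have "real (card (root_ceiling m ` ?Z)) \<le> 2 * c + 1" using c by auto
  then show ?thesis
    using sum_weight_saturated(1)[OF sat] mult_left_mono[of _ "2 * c + 1" "real m"] by fastforce
qed

end

end

section \<open>Density of internal sets\<close>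

definition std_density :: "nat \<Rightarrow> real \<Rightarrow> real set \<Rightarrow> real" where
  "std_density m n S = 1 / (real m * n) * (\<Sum>a\<in>S. weight m a)"

lemma Los4: "[ext p f, ext p g, ext p h, ext p l] \<in> star R \<longleftrightarrow>
    eventually (\<lambda>xs. [f xs, g xs, h xs, l xs] \<in> R) (type_filter p)"
  using Los[of p "[f, g, h, l]" R] by simp

lemma power_density_hcode:
  "power_density (hreal p \<eta>) m (hset (hcode p S)) = st (hreal p (\<lambda>xs. std_density m (\<eta> xs) (S xs)))"
  unfolding power_density_def hsum_hcode hfun2_hreal
  by (simp add: std_density_def[abs_def] weight_def[abs_def])

text \<open>Membership in the sets \<open>A i\<close> is a countable family of conditions with codes
  as parameters, so saturation turns the finite intersection property into a common point.\<close>

lemma internal_Inter_nonempty: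
  fixes A :: "nat \<Rightarrow> 'a::countably_saturated_extension set"
  assumes "\<And>i. internal (A i)" "\<And>n. (\<Inter>i\<le>n. A i) \<noteq> {}"
  shows "(\<Inter>i. A i) \<noteq> {}"
proof -
  obtain s where s: "\<And>i. A i = hset (s i)"
    using assms(1) unfolding internal_iff by metis
  have "\<exists>x. \<forall>i. x # [s i] \<in> star {[Real r, RSet B] | r B. r \<in> B}"
  proof (rule countable_saturation)
    fix n
    obtain x where "x \<in> (\<Inter>i\<le>n. A i)" using assms(2)[of n] by blast
    then show "\<exists>x. \<forall>i\<le>n. x # [s i] \<in> star {[Real r, RSet B] | r B. r \<in> B}"
      by (auto simp: s hset_def)
  qed
  then show ?thesis by (auto simp: s hset_def)
qed

locale power_interval_setup =
  fixes m :: nat and N k :: "'a::countably_saturated_extension"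
  assumes m: "m \<ge> 1" and N: "N \<in> hnats" "infinite_number N" and k: "k \<in> hnats"
begin

abbreviation X :: "'a set" where "X \<equiv> power_interval k N m"

definition internals :: "'a set set" where
  "internals = {A. internal A \<and> A \<subseteq> X}"

text \<open>No tuple is fixed once and for all: each argument enlarges it by the elements at hand,
  so the functions representing \<open>k\<close> and \<open>N\<close> are carried along.\<close>

definition params :: "'a list \<Rightarrow> (univ list \<Rightarrow> real) \<Rightarrow> (univ list \<Rightarrow> real) \<Rightarrow> bool" where
  "params p \<kappa> \<eta> \<longleftrightarrow> k = hreal p \<kappa> \<and> N = hreal p \<eta>"

abbreviation std_X :: "(univ list \<Rightarrow> real) \<Rightarrow> (univ list \<Rightarrow> real) \<Rightarrow> univ list \<Rightarrow> real set" where
  "std_X \<kappa> \<eta> xs \<equiv> std_interval m (\<kappa> xs) (\<eta> xs)"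

lemma params_pos_nats:
  assumes "params p \<kappa> \<eta>"
  shows "eventually (\<lambda>xs. \<kappa> xs \<in> pos_nats \<and> \<eta> xs \<in> pos_nats) (type_filter p)"
  using assms N k by (auto simp: params_def hnats_hreal eventually_conj_iff)

lemma params_at_top:
  assumes "params p \<kappa> \<eta>"
  shows "filterlim \<eta> at_top (type_filter p)"
  unfolding filterlim_at_top
proof
  fix Z :: real
  obtain n where n: "Z \<le> real n" using real_arch_simple by blast
  have "std (Real (real n)) <\<^sub>\<star> N" using N(2) by (simp add: infinite_number_def)
  then have "eventually (\<lambda>xs. real n < \<eta> xs) (type_filter p)"
    using assms hless_hreal[of p "\<lambda>_. real n" \<eta>] by (simp add: params_def)
  then show "eventually (\<lambda>xs. Z \<le> \<eta> xs) (type_filter p)"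
    by eventually_elim (use n in simp)
qed

lemma params_Cons:
  assumes "params p \<kappa> \<eta>"
  shows "params (x # p) (\<lambda>xs. \<kappa> (tl xs)) (\<lambda>xs. \<eta> (tl xs))"
  using assms unfolding params_def hreal_Cons .

lemma X_subset: "X \<subseteq> hreals"
  using hnats_subset by (auto simp: power_interval_def hinterval_def)

lemma hreal_mem_X_iff:
  assumes "params p \<kappa> \<eta>"
  shows "hreal p f \<in> X \<longleftrightarrow> eventually (\<lambda>xs. f xs \<in> std_X \<kappa> \<eta> xs) (type_filter p)"
  using assms unfolding params_def power_interval_def hinterval_def
  by (simp add: hroot_hreal hceiling_hreal hadd_hreal hpower_hreal hle_hreal hnats_hreal
      std_interval_def root_ceiling_def eventually_conj_iff)

lemma X_eq_hset:
  assumes "params p \<kappa> \<eta>"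
  shows "X = hset (hcode p (std_X \<kappa> \<eta>))"
proof (rule set_eqI)
  fix x
  show "x \<in> X \<longleftrightarrow> x \<in> hset (hcode p (std_X \<kappa> \<eta>))"
  proof (cases "x \<in> hreals")
    case True
    then show ?thesis
      using hreal_mem_X_iff[OF params_Cons[OF assms, of x], of "\<lambda>xs. real_of_univ (hd xs)"]
      by (simp add: mem_hset_iff flip: represent_Cons)
  qed (use X_subset hset_subset in auto)
qed

text \<open>Codes of the internal sets are chosen and represented over one tuple with
  \<open>k\<close>, \<open>N\<close> and the given hyperreals; inclusion in \<open>X\<close> then
  becomes an eventual pointwise inclusion.\<close>

lemma params_exist:
  assumes "set rs \<subseteq> hreals" "set As \<subseteq> internals"
  obtains p \<kappa> \<eta> fs Ss where "params p \<kappa> \<eta>" "rs = map (hreal p) fs"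
    "As = map (\<lambda>S. hset (hcode p S)) Ss"
    "eventually (\<lambda>xs. \<forall>S\<in>set Ss. S xs \<subseteq> std_X \<kappa> \<eta> xs) (type_filter p)"
proof -
  define code where "code A = (SOME s. s \<in> hcodes \<and> A = hset s)" for A :: "'a set"
  have code: "code A \<in> hcodes \<and> A = hset (code A)" if "A \<in> set As" for A
  proof -
    have "\<exists>s. s \<in> hcodes \<and> A = hset s" using that assms(2) by (auto simp: internals_def internal_iff)
    then show ?thesis unfolding code_def by (rule someI_ex)
  qed
  obtain p fs Ss where p: "k # N # rs = map (hreal p) fs" "map code As = map (hcode p) Ss"
    by (rule represent[of "k # N # rs" "map code As"]) (use assms(1) N(1) k hnats_subset code in auto)
  then obtain \<kappa> \<eta> fs' where fs: "fs = \<kappa> # \<eta> # fs'" "k = hreal p \<kappa>" "N = hreal p \<eta>" "rs = map (hreal p) fs'"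
    by (auto simp: Cons_eq_map_conv)
  have par: "params p \<kappa> \<eta>" using fs unfolding params_def by blast
  have "As = map hset (map code As)" using code by (simp add: map_idI)
  then have As: "As = map (\<lambda>S. hset (hcode p S)) Ss" using p(2) by (simp add: comp_def)
  have "eventually (\<lambda>xs. \<forall>S\<in>set Ss. S xs \<subseteq> std_X \<kappa> \<eta> xs) (type_filter p)"
  proof (intro eventually_ball_finite ballI)
    fix S assume "S \<in> set Ss"
    then have "hset (hcode p S) \<subseteq> X" using assms(2) As by (auto simp: internals_def)
    then show "eventually (\<lambda>xs. S xs \<subseteq> std_X \<kappa> \<eta> xs) (type_filter p)"
      by (simp add: X_eq_hset[OF par] hset_hcode_subset_iff)
  qed simp
  then show thesis using that par fs(4) As by blast
qed

lemma hset_mem_internals: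
  assumes "params p \<kappa> \<eta>" "eventually (\<lambda>xs. S xs \<subseteq> std_X \<kappa> \<eta> xs) (type_filter p)"
  shows "hset (hcode p S) \<in> internals"
  using assms by (simp add: internals_def X_eq_hset hset_hcode_subset_iff)

text \<open>The bound 2 comes from \<open>\<eta> xs + 1 \<le> 2 * \<eta> xs\<close>, as
  \<open>\<eta> xs\<close> is eventually at least 1.\<close>

lemma density_bounds:
  assumes "params p \<kappa> \<eta>" "eventually (\<lambda>xs. S xs \<subseteq> std_X \<kappa> \<eta> xs) (type_filter p)"
  shows "eventually (\<lambda>xs. 0 \<le> std_density m (\<eta> xs) (S xs) \<and> std_density m (\<eta> xs) (S xs) \<le> 2) (type_filter p)"
  using assms(2) params_pos_nats[OF assms(1)]
proof eventually_elim
  case (elim xs)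
  obtain n where n: "n \<ge> 1" "\<eta> xs = of_int n" using elim pos_nats_int by auto
  have nn: "(\<Sum>a\<in>S xs. weight m a) \<ge> 0" by (simp add: sum_nonneg)
  have "(\<Sum>a\<in>S xs. weight m a) \<le> (\<Sum>a\<in>std_X \<kappa> \<eta> xs. weight m a)"
    using elim by (intro sum_mono2) auto
  also have "\<dots> \<le> real m * (\<eta> xs + 1)"
    using sum_weight_std_interval[OF m _ n(2,1)] elim by blast
  also have "\<dots> \<le> real m * (2 * \<eta> xs)" using n by (intro mult_left_mono) auto
  finally have "(\<Sum>a\<in>S xs. weight m a) \<le> 2 * (real m * \<eta> xs)" by (simp add: mult_ac)
  moreover have "real m * \<eta> xs > 0" using m n by simp
  ultimately show ?case using nn by (simp add: std_density_def pos_divide_le_eq)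
qed

text \<open>Being bounded, the pointwise density has a limit along the ultrafilter, and this limit
  is the standard part in \<open>power_density\<close>.\<close>

lemma density_tendsto:
  assumes "params p \<kappa> \<eta>" "eventually (\<lambda>xs. S xs \<subseteq> std_X \<kappa> \<eta> xs) (type_filter p)"
  shows "((\<lambda>xs. std_density m (\<eta> xs) (S xs)) \<longlongrightarrow> power_density N m (hset (hcode p S))) (type_filter p)"
proof -
  have "eventually (\<lambda>xs. \<bar>std_density m (\<eta> xs) (S xs)\<bar> \<le> 2) (type_filter p)"
    using density_bounds[OF assms] by eventually_elim auto
  then obtain r where r: "((\<lambda>xs. std_density m (\<eta> xs) (S xs)) \<longlongrightarrow> r) (type_filter p)"
    by (rule bounded_tendsto_type_filter)
  then have "power_density N m (hset (hcode p S)) = r"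
    using assms(1) by (simp add: params_def power_density_hcode st_hreal_eqI)
  then show ?thesis using r by simp
qed

section \<open>Finite additivity of the density on internal sets\<close>

lemma internals_nonneg:
  assumes "A \<in> internals"
  shows "0 \<le> power_density N m A"
proof -
  obtain p \<kappa> \<eta> fs Ss where p: "params p \<kappa> \<eta>" "[] = map (hreal p) fs" "[A] = map (\<lambda>S. hset (hcode p S)) Ss"
    "eventually (\<lambda>xs. \<forall>S\<in>set Ss. S xs \<subseteq> std_X \<kappa> \<eta> xs) (type_filter p)"
    by (rule params_exist[of "[]" "[A]"]) (use assms in auto)
  then obtain S where S: "A = hset (hcode p S)" "eventually (\<lambda>xs. S xs \<subseteq> std_X \<kappa> \<eta> xs) (type_filter p)"
    by (auto simp: Cons_eq_map_conv)
  show ?thesis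
    using density_tendsto[OF p(1) S(2)] density_bounds[OF p(1) S(2)]
    by (intro tendsto_lowerbound[where F = "type_filter p"]) (auto simp: S(1) elim!: eventually_mono)
qed

lemma represent_internals2:
  assumes "A \<in> internals" "B \<in> internals"
  obtains p \<kappa> \<eta> S T where "params p \<kappa> \<eta>" "A = hset (hcode p S)" "B = hset (hcode p T)"
    "eventually (\<lambda>xs. S xs \<subseteq> std_X \<kappa> \<eta> xs) (type_filter p)"
    "eventually (\<lambda>xs. T xs \<subseteq> std_X \<kappa> \<eta> xs) (type_filter p)"
proof -
  obtain p \<kappa> \<eta> fs Ss where p: "params p \<kappa> \<eta>" "[] = map (hreal p) fs" "[A, B] = map (\<lambda>S. hset (hcode p S)) Ss"
    "eventually (\<lambda>xs. \<forall>S\<in>set Ss. S xs \<subseteq> std_X \<kappa> \<eta> xs) (type_filter p)"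
    by (rule params_exist[of "[]" "[A, B]"]) (use assms in auto)
  then show thesis using that by (auto simp: Cons_eq_map_conv eventually_conj_iff)
qed

lemma X_internals: "X \<in> internals"
proof -
  obtain p \<kappa> \<eta> fs Ss where p: "params p \<kappa> \<eta>" "[] = map (hreal p) fs" "[] = map (\<lambda>S. hset (hcode p S)) Ss"
    "eventually (\<lambda>xs. \<forall>S\<in>set Ss. S xs \<subseteq> std_X \<kappa> \<eta> xs) (type_filter p)"
    by (rule params_exist[of "[]" "[]"]) auto
  then show ?thesis using X_eq_hset[of p \<kappa> \<eta>] hset_mem_internals[of p \<kappa> \<eta> "std_X \<kappa> \<eta>"] by simp
qed

lemma Diff_internals:
  assumes "A \<in> internals" "B \<in> internals"
  shows "A - B \<in> internals"
  using represent_internals2[OF assms]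
proof cases
  case (1 p \<kappa> \<eta> S T)
  then show ?thesis
    by (auto simp: hset_Diff intro!: hset_mem_internals elim!: eventually_mono)
qed

lemma Un_internals:
  assumes "A \<in> internals" "B \<in> internals"
  shows "A \<union> B \<in> internals"
  using represent_internals2[OF assms]
proof cases
  case (1 p \<kappa> \<eta> S T)
  have "eventually (\<lambda>xs. S xs \<union> T xs \<subseteq> std_X \<kappa> \<eta> xs) (type_filter p)"
    using 1(4,5) by eventually_elim auto
  then show ?thesis using 1 by (simp add: hset_Un hset_mem_internals)
qed

lemma algebra_internals: "algebra X internals"
proof (rule algebra_iff_Un[THEN iffD2], intro conjI ballI)
  show "{} \<in> internals" using Diff_internals[OF X_internals X_internals] by simp
qed (use Un_internals Diff_internals X_internals in \<open>auto simp: internals_def\<close>)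

lemma density_additive:
  assumes "A \<in> internals" "B \<in> internals" "A \<inter> B = {}"
  shows "power_density N m (A \<union> B) = power_density N m A + power_density N m B"
  using represent_internals2[OF assms(1,2)]
proof cases
  case (1 p \<kappa> \<eta> S T)
  \<comment> \<open>Comparison with the code of the empty set turns disjointness into an eventual
    pointwise statement.\<close>
  have "hset (hcode p (\<lambda>xs. S xs \<inter> T xs)) = hset (hcode p (\<lambda>_. {}))"
    using assms(3) 1 by (simp add: hset_Int hset_empty)
  then have disj: "eventually (\<lambda>xs. S xs \<inter> T xs = {}) (type_filter p)"
    by (simp add: hset_hcode_eq_iff hcode_eq_iff)
  have sub: "eventually (\<lambda>xs. S xs \<union> T xs \<subseteq> std_X \<kappa> \<eta> xs) (type_filter p)"
    using 1(4,5) by eventually_elim auto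
  have "eventually (\<lambda>xs. std_density m (\<eta> xs) (S xs) + std_density m (\<eta> xs) (T xs) =
      std_density m (\<eta> xs) (S xs \<union> T xs)) (type_filter p)"
    using disj 1(4,5)
  proof eventually_elim
    case (elim xs)
    then have "finite (S xs)" "finite (T xs)" using finite_std_interval finite_subset by blast+
    then show ?case using elim by (simp add: std_density_def sum.union_disjoint distrib_left)
  qed
  then have "((\<lambda>xs. std_density m (\<eta> xs) (S xs \<union> T xs)) \<longlongrightarrow>
      power_density N m (hset (hcode p S)) + power_density N m (hset (hcode p T))) (type_filter p)"
    using tendsto_add[OF density_tendsto[OF 1(1,4)] density_tendsto[OF 1(1,5)]]
    by (auto elim: Lim_transform_eventually)
  then show ?thesis
    using tendsto_unique[OF _ density_tendsto[OF 1(1) sub]] 1(2,3) by (simp add: hset_Un)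
qed

lemma density_mono:
  assumes "A \<in> internals" "B \<in> internals" "A \<subseteq> B"
  shows "power_density N m A \<le> power_density N m B"
proof -
  have "B - A \<in> internals" using assms by (intro Diff_internals)
  then have "power_density N m (A \<union> (B - A)) = power_density N m A + power_density N m (B - A)"
    using assms by (intro density_additive) auto
  moreover have "A \<union> (B - A) = B" using assms by blast
  ultimately show ?thesis using internals_nonneg[OF \<open>B - A \<in> internals\<close>] by simp
qed

lemma density_null:
  assumes A: "A \<in> internals" and Z: "Z \<in> internals" "power_density N m Z = 0"
  shows "power_density N m (A - Z) = power_density N m A" "power_density N m (A \<union> Z) = power_density N m A"
proof -
  have diff: "A - Z \<in> internals" "Z \<union> A \<in> internals" using A Z by (simp_all add: Diff_internals Un_internals)
  have "power_density N m ((A - Z) \<union> Z) = power_density N m (A - Z) + power_density N m Z"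
    using diff Z by (intro density_additive) auto
  moreover have "(A - Z) \<union> Z = A \<union> Z" by blast
  moreover have "power_density N m A \<le> power_density N m (A \<union> Z)" "power_density N m (A - Z) \<le> power_density N m A"
    using A diff by (auto intro!: density_mono simp: Un_commute)
  ultimately show "power_density N m (A - Z) = power_density N m A"
    "power_density N m (A \<union> Z) = power_density N m A" using Z(2) by auto
qed

text \<open>Saturation replaces the union of the \<open>F i\<close>, which need not be internal, by
  an internal superset. The slack \<open>e\<close> enters because a standard part of at most
  \<open>L\<close> bounds the internal density only by \<open>L + e\<close>.\<close>

lemma internal_cover:
  assumes F: "\<And>i::nat. F i \<in> internals" and L: "\<And>n. power_density N m (\<Union>i\<le>n. F i) \<le> L" and e: "e > 0"
  obtains G where "G \<in> internals" "\<And>i. F i \<subseteq> G" "power_density N m G \<le> L + e"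
proof -
  \<comment> \<open>The conditions to be realized together: \<open>T\<close> is the cover sought,
    \<open>S\<close> one of the \<open>F i\<close>, \<open>Y\<close> the interval and
    \<open>n\<close> its length parameter.\<close>
  let ?R = "{[RSet T, RSet S, RSet Y, Real n] | T S Y n. S \<subseteq> T \<and> T \<subseteq> Y \<and> std_density m n T \<le> L + e}"
  obtain s where s: "\<And>i. s i \<in> hcodes" "\<And>i. F i = hset (s i)"
    using F unfolding internals_def internal_iff by simp metis
  obtain x where x: "x \<in> hcodes" "X = hset x"
    using X_internals unfolding internals_def internal_iff by auto
  have introR: "[t, s i, x, N] \<in> star ?R"
    if A: "A \<in> internals" and t: "t \<in> hcodes" "A = hset t" and sub: "F i \<subseteq> A"
      and d: "power_density N m A \<le> L" for A t i
    using represent_internals2[OF A F[of i]]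
  proof cases
    case (1 p \<kappa> \<eta> T S)
    have eq: "t = hcode p T" "s i = hcode p S" "x = hcode p (std_X \<kappa> \<eta>)" "N = hreal p \<eta>"
      using t s x 1 X_eq_hset[OF 1(1)] by (auto intro!: hset_inject simp: params_def)
    have "eventually (\<lambda>xs. std_density m (\<eta> xs) (T xs) < L + e) (type_filter p)"
      using density_tendsto[OF 1(1,4)] d e 1(2) by (intro order_tendstoD(2)) auto
    moreover have "eventually (\<lambda>xs. S xs \<subseteq> T xs) (type_filter p)"
      using sub 1 by (simp add: hset_hcode_subset_iff)
    ultimately have "eventually (\<lambda>xs. [RSet (T xs), RSet (S xs), RSet (std_X \<kappa> \<eta> xs), Real (\<eta> xs)] \<in> ?R) (type_filter p)"
      using 1(4) by eventually_elim auto
    then show ?thesis unfolding eq hcode_def hreal_def Los4 .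
  qed
  \<comment> \<open>Conversely, the realized bound is non-strict and survives passing to the
    limit.\<close>
  have elimR: "hset t \<in> internals \<and> F i \<subseteq> hset t \<and> power_density N m (hset t) \<le> L + e"
    if R: "[t, s i, x, N] \<in> star ?R" for t i
  proof -
    have "map ((!) [t, s i, x, N]) [0] \<in> star {[RSet B] | B. True}"
      using R by (subst star_reindex) (auto elim!: star_mono[rotated])
    then have t: "t \<in> hcodes" by (simp add: hcodes_def)
    obtain p fs Ss where p: "[k, N] = map (hreal p) fs" "[t, s i] = map (hcode p) Ss"
      by (rule represent[of "[k, N]" "[t, s i]"]) (use N(1) k t s hnats_subset in auto)
    then obtain \<kappa> \<eta> T S where eq: "k = hreal p \<kappa>" "N = hreal p \<eta>" "t = hcode p T" "s i = hcode p S"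
      by (auto simp: Cons_eq_map_conv)
    then have par: "params p \<kappa> \<eta>" unfolding params_def by blast
    have x': "x = hcode p (std_X \<kappa> \<eta>)" using x X_eq_hset[OF par] by (auto intro!: hset_inject)
    have ev: "eventually (\<lambda>xs. S xs \<subseteq> T xs \<and> T xs \<subseteq> std_X \<kappa> \<eta> xs \<and> std_density m (\<eta> xs) (T xs) \<le> L + e) (type_filter p)"
      using R unfolding eq(2-) x' hcode_def hreal_def Los4 by simp
    then have sub: "eventually (\<lambda>xs. T xs \<subseteq> std_X \<kappa> \<eta> xs) (type_filter p)" by eventually_elim auto
    have "hset t \<in> internals" using hset_mem_internals[OF par sub] eq by simp
    moreover have "F i \<subseteq> hset t" using ev s eq by (auto simp: hset_hcode_subset_iff elim!: eventually_mono)
    moreover have "power_density N m (hset t) \<le> L + e"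
      using density_tendsto[OF par sub] ev unfolding eq(3)
      by (intro tendsto_upperbound[where F = "type_filter p"]) (auto elim!: eventually_mono)
    ultimately show ?thesis by blast
  qed
  have "\<exists>t. \<forall>i. t # [s i, x, N] \<in> star ?R"
  proof (rule countable_saturation)
    fix n
    \<comment> \<open>The finite union satisfies the first \<open>n + 1\<close> conditions
      simultaneously.\<close>
    have Un: "(\<Union>i\<le>n. F i) \<in> internals"
    proof (induction n)
      case (Suc n)
      then show ?case using Un_internals[OF F[of "Suc n"] Suc] by (simp add: atMost_Suc)
    qed (use F in simp)
    then obtain t where "t \<in> hcodes" "(\<Union>i\<le>n. F i) = hset t"
      by (auto simp: internals_def internal_iff)
    then show "\<exists>t. \<forall>i\<le>n. t # [s i, x, N] \<in> star ?R"
      using introR[OF Un _ _ _ L] by blast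
  qed
  then obtain t where "\<And>i. [t, s i, x, N] \<in> star ?R" by auto
  then show thesis using elimR that by blast
qed

end

section \<open>Loeb measure\<close>

context power_interval_setup
begin

definition premeasure_extension :: "'a measure" where
  "premeasure_extension = extend_measure X internals (\<lambda>A. A) (\<lambda>A. ennreal (power_density N m A))"

lemma loeb_measure_eq: "loeb_measure k N m = completion premeasure_extension"
  by (simp add: loeb_measure_def premeasure_extension_def internals_def)

text \<open>Decreasing internal sets with empty intersection are eventually empty by saturation, so
  continuity at the empty set is immediate and Caratheodory's theorem applies.\<close>

lemma density_extends:
  "\<exists>\<mu>. (\<forall>A\<in>internals. \<mu> A = ennreal (power_density N m A)) \<and> measure_space X (sigma_sets X internals) \<mu>"
proof -
  interpret algebra X internals by (rule algebra_internals)
  have empty: "power_density N m {} = 0" using density_additive[of "{}" "{}"] by simp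
  show ?thesis
  proof (rule caratheodory_empty_continuous)
    show "positive internals (\<lambda>A. ennreal (power_density N m A))" by (simp add: positive_def empty)
    show "additive internals (\<lambda>A. ennreal (power_density N m A))"
      by (simp add: additive_def density_additive internals_nonneg ennreal_plus)
    fix A :: "nat \<Rightarrow> 'a set"
    assume A: "range A \<subseteq> internals" "decseq A" "(\<Inter>i. A i) = {}"
    have "\<exists>n. (\<Inter>i\<le>n. A i) = {}"
      using internal_Inter_nonempty[of A] A unfolding internals_def by blast
    then obtain n where n: "(\<Inter>i\<le>n. A i) = {}" by blast
    have "A n \<subseteq> (\<Inter>i\<le>n. A i)" using decseqD[OF A(2)] by blast
    then have "A i = {}" if "i \<ge> n" for i using decseqD[OF A(2) that] n by blast
    then have "eventually (\<lambda>i. ennreal (power_density N m (A i)) = 0) sequentially"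
      unfolding eventually_sequentially using empty by (intro exI[of _ n]) simp
    then show "(\<lambda>i. ennreal (power_density N m (A i))) \<longlonglongrightarrow> 0" by (rule tendsto_eventually)
  qed simp
qed

lemma space_premeasure_extension [simp]: "space premeasure_extension = X"
  unfolding premeasure_extension_def by (rule space_extend_measure) (auto simp: internals_def)

lemma sets_premeasure_extension: "sets premeasure_extension = sigma_sets X internals"
  unfolding premeasure_extension_def by (subst sets_extend_measure) (auto simp: internals_def)

lemma internals_sets [simp]: "A \<in> internals \<Longrightarrow> A \<in> sets premeasure_extension"
  by (simp add: sets_premeasure_extension)

lemma emeasure_internal:
  assumes "A \<in> internals"
  shows "emeasure premeasure_extension A = ennreal (power_density N m A)"
proof -
  obtain \<mu> where "\<forall>A\<in>internals. \<mu> A = ennreal (power_density N m A)" "measure_space X (sigma_sets X internals) \<mu>"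
    using density_extends by blast
  then show ?thesis
    using emeasure_extend_measure[OF premeasure_extension_def, of \<mu> A] assms
    by (auto simp: measure_space_def sets_premeasure_extension internals_def)
qed

lemma measure_internal: "A \<in> internals \<Longrightarrow> measure premeasure_extension A = power_density N m A"
  by (simp add: measure_def emeasure_internal internals_nonneg)

sublocale premeasure: finite_measure premeasure_extension
  by standard (simp add: emeasure_internal X_internals)

section \<open>Approximation of measurable sets by internal sets\<close>

lemma UN_atMost_internals:
  assumes "\<And>i::nat. F i \<in> internals"
  shows "(\<Union>i\<le>n. F i) \<in> internals"
proof -
  interpret algebra X internals by (rule algebra_internals)
  show ?thesis using assms by (intro finite_UN) auto
qed

text \<open>The difference of the unions is covered by the differences \<open>F i - D i\<close>,
  whose measures are dominated by a geometric series of sum \<open>e\<close>.\<close>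

lemma measure_cover_excess:
  fixes D F :: "nat \<Rightarrow> 'a set"
  assumes D: "\<And>i. D i \<in> internals" and F: "\<And>i. F i \<in> internals"
    and "\<And>i. D i \<subseteq> F i"
    and le: "\<And>i. measure premeasure_extension (F i) - measure premeasure_extension (D i) \<le> e * (1 / 2) ^ Suc i"
  shows "measure premeasure_extension (\<Union>i. F i) \<le> measure premeasure_extension (\<Union>i. D i) + e"
proof -
  let ?\<mu> = "measure premeasure_extension"
  have sets: "D i \<in> sets premeasure_extension" "F i \<in> sets premeasure_extension" for i
    using D F by auto
  have geo: "(\<lambda>i. e * (1 / 2) ^ Suc i) sums (e * 1)"
    by (intro sums_mult) (use power_half_series in simp)
  have diff: "?\<mu> (F i - D i) \<le> e * (1 / 2) ^ Suc i" for i
    using le[of i] assms(3)[of i] sets[of i] by (simp add: premeasure.finite_measure_Diff)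
  have sm: "summable (\<lambda>i. ?\<mu> (F i - D i))"
    using sums_summable[OF geo] by (rule summable_comparison_test') (use diff in auto)
  have "?\<mu> (\<Union>i. F i - D i) \<le> (\<Sum>i. ?\<mu> (F i - D i))"
    using sets sm by (intro premeasure.finite_measure_subadditive_countably) auto
  also have "\<dots> \<le> (\<Sum>i. e * (1 / 2) ^ Suc i)"
    using diff sm sums_summable[OF geo] by (intro suminf_le) auto
  also have "\<dots> = e" using geo by (simp add: sums_iff)
  finally have ex: "?\<mu> (\<Union>i. F i - D i) \<le> e" .
  have "?\<mu> (\<Union>i. F i) \<le> ?\<mu> ((\<Union>i. D i) \<union> (\<Union>i. F i - D i))"
    using sets by (intro premeasure.finite_measure_mono) auto
  also have "\<dots> \<le> ?\<mu> (\<Union>i. D i) + ?\<mu> (\<Union>i. F i - D i)"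
    using sets by (intro measure_Un_le) auto
  finally show ?thesis using ex by simp
qed

text \<open>The approximable sets form a sigma-algebra: complements exchange inner and outer sets,
  and for countable unions saturation supplies the outer set while a finite partial union supplies
  the inner one.\<close>

lemma sigma_sets_approx:
  assumes "B \<in> sets premeasure_extension" "e > 0"
  shows "\<exists>D\<in>internals. \<exists>F\<in>internals. D \<subseteq> B \<and> B \<subseteq> F \<and>
    measure premeasure_extension F - measure premeasure_extension D \<le> e"
  using assms unfolding sets_premeasure_extension
proof (induction B arbitrary: e rule: sigma_sets.induct)
  case (Basic A)
  then show ?case by (intro bexI[of _ A]) auto
next
  case Empty
  have "{} \<in> internals" using Diff_internals[OF X_internals X_internals] by simp
  then show ?case using Empty by (intro bexI[of _ "{}"]) auto
next
  case (Compl A)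
  then obtain D F where DF: "D \<in> internals" "F \<in> internals" "D \<subseteq> A" "A \<subseteq> F"
    "measure premeasure_extension F - measure premeasure_extension D \<le> e" by metis
  have "measure premeasure_extension (X - D) = measure premeasure_extension X - measure premeasure_extension D"
    "measure premeasure_extension (X - F) = measure premeasure_extension X - measure premeasure_extension F"
    using DF X_internals by (auto intro!: premeasure.finite_measure_Diff simp: internals_def)
  then show ?case
    using DF Diff_internals[OF X_internals, of D] Diff_internals[OF X_internals, of F]
    by (intro bexI[of _ "X - F"] bexI[of _ "X - D"]) auto
next
  \<comment> \<open>One third of \<open>e\<close> each goes to the individual approximations, to the
    internal cover \<open>G\<close> and to the truncation of the inner union.\<close>
  case (Union B)
  let ?\<mu> = "measure premeasure_extension"
  have "\<exists>D F. D \<in> internals \<and> F \<in> internals \<and> D \<subseteq> B i \<and> B i \<subseteq> F \<and> ?\<mu> F - ?\<mu> D \<le> e / 3 * (1 / 2) ^ Suc i" for i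
    using Union.IH[of "e / 3 * (1 / 2) ^ Suc i" i] Union.prems by auto
  then obtain D F where DF: "\<And>i. D i \<in> internals" "\<And>i. F i \<in> internals" "\<And>i. D i \<subseteq> B i" "\<And>i. B i \<subseteq> F i"
    "\<And>i. ?\<mu> (F i) - ?\<mu> (D i) \<le> e / 3 * (1 / 2) ^ Suc i" by metis
  have excess: "?\<mu> (\<Union>i. F i) \<le> ?\<mu> (\<Union>i. D i) + e / 3"
    by (rule measure_cover_excess) (fact DF(1) DF(2) DF(5) order_trans[OF DF(3,4)])+
  have sets: "D i \<in> sets premeasure_extension" "F i \<in> sets premeasure_extension" for i
    using DF(1,2) by auto
  have cover: "power_density N m (\<Union>i\<le>n. F i) \<le> ?\<mu> (\<Union>i. F i)" for n
  proof -
    have "?\<mu> (\<Union>i\<le>n. F i) \<le> ?\<mu> (\<Union>i. F i)"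
      using sets by (intro premeasure.finite_measure_mono) auto
    then show ?thesis using measure_internal[OF UN_atMost_internals[of F n, OF DF(2)]] by simp
  qed
  obtain G where G: "G \<in> internals" "\<And>i. F i \<subseteq> G" "power_density N m G \<le> ?\<mu> (\<Union>i. F i) + e / 3"
    by (rule internal_cover[of F "?\<mu> (\<Union>i. F i)" "e / 3", OF DF(2) cover]) (use Union.prems in auto)
  have "(\<lambda>n. ?\<mu> (\<Union>i\<le>n. D i)) \<longlonglongrightarrow> ?\<mu> (\<Union>n. \<Union>i\<le>n. D i)"
    using sets by (intro premeasure.finite_Lim_measure_incseq) (auto simp: incseq_def intro: order_trans)
  also have "(\<Union>n. \<Union>i\<le>n. D i) = (\<Union>i. D i)" by auto
  finally have "eventually (\<lambda>n. ?\<mu> (\<Union>i. D i) - e / 3 < ?\<mu> (\<Union>i\<le>n. D i)) sequentially"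
    using Union.prems by (intro order_tendstoD(1)) auto
  then obtain n where n: "?\<mu> (\<Union>i. D i) - e / 3 < ?\<mu> (\<Union>i\<le>n. D i)"
    by (auto dest: eventually_happens)
  have "?\<mu> G - ?\<mu> (\<Union>i\<le>n. D i) \<le> e"
    using n excess G by (simp add: measure_internal)
  moreover have "(\<Union>i\<le>n. D i) \<subseteq> (\<Union>i. B i)" "(\<Union>i. B i) \<subseteq> G" using DF(3,4) G(2) by blast+
  ultimately show ?case using G(1) UN_atMost_internals[of D n, OF DF(1)] by blast
qed

section \<open>The completed Loeb measure\<close>

lemma space_loeb [simp]: "space (loeb_measure k N m) = X"
  by (simp add: loeb_measure_eq)

lemma internals_loeb [simp]: "A \<in> internals \<Longrightarrow> A \<in> sets (loeb_measure k N m)"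
  by (simp add: loeb_measure_eq)

lemma measure_loeb_internal: "A \<in> internals \<Longrightarrow> measure (loeb_measure k N m) A = power_density N m A"
  by (simp add: loeb_measure_eq measure_internal)

lemma finite_measure_loeb: "finite_measure (loeb_measure k N m)"
proof (rule finite_measureI)
  show "emeasure (loeb_measure k N m) (space (loeb_measure k N m)) \<noteq> \<infinity>"
    by (simp add: loeb_measure_eq emeasure_internal X_internals)
qed

lemma loeb_fmeasurable: "A \<in> sets (loeb_measure k N m) \<Longrightarrow> A \<in> fmeasurable (loeb_measure k N m)"
  using finite_measure.fmeasurable_eq_sets[OF finite_measure_loeb] by simp

text \<open>A set measurable for the completion has a superset of the same measure in the
  uncompleted sigma-algebra, which is then approximated; halving \<open>e\<close> makes the
  inequality strict.\<close>

lemma loeb_outer_approx: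
  assumes B: "B \<in> sets (loeb_measure k N m)" and e: "e > 0"
  shows "\<exists>F\<in>internals. B \<subseteq> F \<and> power_density N m F < measure (loeb_measure k N m) B + e"
proof -
  obtain A where A: "B \<subseteq> A" "A \<in> sets premeasure_extension"
    "A - B \<in> null_sets (loeb_measure k N m)"
    "emeasure (loeb_measure k N m) B = emeasure premeasure_extension A"
    unfolding loeb_measure_eq by (rule completion_upper[OF B[unfolded loeb_measure_eq]])
  obtain D F where DF: "D \<in> internals" "F \<in> internals" "D \<subseteq> A" "A \<subseteq> F"
    "measure premeasure_extension F - measure premeasure_extension D \<le> e / 2"
    using sigma_sets_approx[OF A(2) half_gt_zero[OF e]] by blast
  have "measure premeasure_extension D \<le> measure premeasure_extension A"
    using DF A by (intro premeasure.finite_measure_mono) auto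
  moreover have "measure (loeb_measure k N m) B = measure premeasure_extension A"
    using A(4) by (simp add: measure_def)
  ultimately have "power_density N m F < measure (loeb_measure k N m) B + e"
    using DF(5) e measure_internal[OF DF(2)] by linarith
  then show ?thesis using DF A by blast
qed

text \<open>Obtained by complementing an outer approximation of the complement.\<close>

lemma loeb_inner_approx:
  assumes B: "B \<in> sets (loeb_measure k N m)" and e: "e > 0"
  shows "\<exists>D\<in>internals. D \<subseteq> B \<and> power_density N m D > measure (loeb_measure k N m) B - e"
proof -
  interpret loeb: finite_measure "loeb_measure k N m" by (rule finite_measure_loeb)
  have BX: "B \<subseteq> X" using sets.sets_into_space[OF B] by simp
  obtain F where F: "F \<in> internals" "X - B \<subseteq> F"
    "power_density N m F < measure (loeb_measure k N m) (X - B) + e"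
    using loeb_outer_approx[OF sets.compl_sets[OF B] e] by auto
  have "measure (loeb_measure k N m) (X - B) = measure (loeb_measure k N m) X - measure (loeb_measure k N m) B"
    using B BX by (intro loeb.finite_measure_Diff) (auto simp: X_internals)
  moreover have "power_density N m (X - F) = power_density N m X - power_density N m F"
    using F X_internals loeb.finite_measure_Diff[of X F] Diff_internals[OF X_internals F(1)]
    by (simp add: internals_def flip: measure_loeb_internal)
  ultimately show ?thesis
    using F Diff_internals[OF X_internals F(1)] X_internals
    by (intro bexI[of _ "X - F"]) (auto simp: measure_loeb_internal)
qed

text \<open>Completeness makes a set measurable once internal sets of nearly equal density enclose
  it. Measurability and value come together, as needed for preimages not known to be measurable
  beforehand.\<close>

lemma loeb_sandwich:
  assumes "\<And>e. e > 0 \<Longrightarrow> \<exists>D\<in>internals. D \<subseteq> B \<and> r - e < power_density N m D"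
    and "\<And>e. e > 0 \<Longrightarrow> \<exists>F\<in>internals. B \<subseteq> F \<and> power_density N m F < r + e"
  shows "B \<in> sets (loeb_measure k N m)" "measure (loeb_measure k N m) B = r"
proof -
  have "B \<in> fmeasurable (loeb_measure k N m) \<and> r = measure (loeb_measure k N m) B"
    unfolding loeb_measure_eq completion.fmeasurable_measure_inner_outer
    unfolding loeb_measure_eq[symmetric]
  proof (intro conjI allI impI)
    fix e :: real assume "e > 0"
    then obtain D F where "D \<in> internals" "D \<subseteq> B" "r - e < power_density N m D"
      "F \<in> internals" "B \<subseteq> F" "power_density N m F < r + e"
      using assms by meson
    then have "D \<in> fmeasurable (loeb_measure k N m) \<and> D \<subseteq> B \<and> r - e < measure (loeb_measure k N m) D"
      "F \<in> fmeasurable (loeb_measure k N m) \<and> B \<subseteq> F \<and> measure (loeb_measure k N m) F < r + e"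
      by (auto simp: measure_loeb_internal intro: loeb_fmeasurable)
    then show "\<exists>T\<in>fmeasurable (loeb_measure k N m). T \<subseteq> B \<and> r - e < measure (loeb_measure k N m) T"
      and "\<exists>U\<in>fmeasurable (loeb_measure k N m). B \<subseteq> U \<and> measure (loeb_measure k N m) U < r + e"
      by blast+
  qed
  then show "B \<in> sets (loeb_measure k N m)" "measure (loeb_measure k N m) B = r" by auto
qed

end

section \<open>Cuts and the shift\<close>

locale cut_shift_setup = power_interval_setup m N k for m and N k :: "'a::countably_saturated_extension" +
  fixes U V :: "'a set" and c :: 'a
  assumes cut: "additive_cut U" and largest: "largest_additive_cut N V" and c: "c \<in> V - U"
begin

section \<open>Arithmetic of the cut\<close>

lemma U_hnats: "u \<in> U \<Longrightarrow> u \<in> hnats"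
  using cut by (auto simp: additive_cut_def)

lemma c_hnats: "c \<in> hnats"
  using c largest by (auto simp: largest_additive_cut_def additive_cut_def)

lemma U_add: "u \<in> U \<Longrightarrow> v \<in> U \<Longrightarrow> u +\<^sub>\<star> v \<in> U"
  using cut by (auto simp: additive_cut_def)

text \<open>Supplies the unit that absorbs rounding by \<open>hceiling\<close> in the arguments
  below.\<close>

lemma one_mem_U: "std (Real 1) \<in> U"
proof -
  have "infinite U" using cut by (simp add: additive_cut_def)
  then obtain u where u: "u \<in> U" by (metis ex_in_conv finite.emptyI)
  then have ur: "u = hreal [u] (\<lambda>xs. real_of_univ (hd xs))"
    using U_hnats hnats_subset by (intro represent_Cons) auto
  have "hreal [u] (\<lambda>xs. real_of_univ (hd xs)) \<in> hnats" using u ur U_hnats by simp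
  then have "hreal [u] (\<lambda>_. 1) \<le>\<^sub>\<star> hreal [u] (\<lambda>xs. real_of_univ (hd xs))"
    unfolding hnats_hreal hle_hreal by eventually_elim (auto simp: pos_nats_def)
  moreover have "hreal [u] (\<lambda>_. 1) \<in> hnats"
    unfolding hnats_hreal by (auto simp: pos_nats_def intro!: exI[of _ 1])
  ultimately have "std (Real 1) \<le>\<^sub>\<star> u" "std (Real 1) \<in> (hnats :: 'a set)"
    using ur by simp_all
  then show ?thesis using cut u unfolding additive_cut_def by blast
qed

text \<open>Otherwise \<open>c\<close> would lie below an element of the initial segment
  \<open>U\<close> and hence belong to it.\<close>

lemma U_less_c:
  assumes "u \<in> U" shows "u <\<^sub>\<star> c"
proof (rule ccontr)
  assume not: "\<not> u <\<^sub>\<star> c"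
  obtain p fs Ss where p: "[u, c] = map (hreal p) fs" "[] = map (hcode p) Ss"
    by (rule represent[of "[u, c]" "[]"]) (use assms U_hnats c_hnats hnats_subset in auto)
  then obtain f g where fg: "u = hreal p f" "c = hreal p g" by (auto simp: Cons_eq_map_conv)
  have "c \<le>\<^sub>\<star> u"
    using not unfolding fg hless_hreal hle_hreal by (simp add: not_less flip: type_filter_ultra)
  then show False using cut assms c c_hnats unfolding additive_cut_def by blast
qed

text \<open>Closure under addition puts every finite multiple of \<open>c\<close> into
  \<open>V\<close>, hence below \<open>N\<close>; so the quotient is smaller than every standard
  positive real.\<close>

lemma c_over_N_tendsto:
  assumes "params p \<kappa> \<eta>" "c = hreal p \<gamma>"
  shows "((\<lambda>xs. \<gamma> xs / \<eta> xs) \<longlongrightarrow> 0) (type_filter p)"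
proof -
  have V: "additive_cut V" "V \<subseteq> hinterval (std (Real 1)) N"
    using largest by (auto simp: largest_additive_cut_def)
  have mult: "hreal p (\<lambda>xs. real (Suc n) * \<gamma> xs) \<in> V" for n
  proof (induction n)
    case 0
    then show ?case using c assms(2) by simp
  next
    case (Suc n)
    have "hreal p (\<lambda>xs. real (Suc n) * \<gamma> xs) +\<^sub>\<star> hreal p \<gamma> \<in> V"
      using V(1) Suc c assms(2) unfolding additive_cut_def by blast
    then show ?case by (simp add: hadd_hreal algebra_simps)
  qed
  have le: "eventually (\<lambda>xs. real (Suc n) * \<gamma> xs \<le> \<eta> xs) (type_filter p)" for n
    using mult[of n] V(2) assms(1) unfolding hinterval_def params_def by (auto simp: hle_hreal)
  have cpos: "eventually (\<lambda>xs. \<gamma> xs \<in> pos_nats) (type_filter p)"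
    using c_hnats assms(2) by (simp add: hnats_hreal)
  show ?thesis
  proof (rule tendstoI)
    fix e :: real assume "e > 0"
    then obtain n where n: "inverse (real (Suc n)) < e" using reals_Archimedean by blast
    show "eventually (\<lambda>xs. dist (\<gamma> xs / \<eta> xs) 0 < e) (type_filter p)"
      using le[of n] cpos params_pos_nats[OF assms(1)]
    proof eventually_elim
      case (elim xs)
      then have pos: "\<gamma> xs > 0" "\<eta> xs > 0" by (auto simp: pos_nats_def)
      then have "\<gamma> xs / \<eta> xs \<le> inverse (real (Suc n))"
        using elim(1) by (simp add: field_simps)
      then show ?case using n pos by (simp add: dist_real_def)
    qed
  qed
qed

section \<open>Cut equivalence and its compatibility with the shift\<close>

lemma cut_equiv_sym:
  assumes "a \<in> hreals" "b \<in> hreals" "cut_equiv m U a b"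
  shows "cut_equiv m U b a"
proof -
  obtain p fs Ss where p: "[a, b] = map (hreal p) fs" "[] = map (hcode p) Ss"
    by (rule represent[of "[a, b]" "[]"]) (use assms in auto)
  then obtain f g where fg: "a = hreal p f" "b = hreal p g" by (auto simp: Cons_eq_map_conv)
  show ?thesis using assms(3) unfolding cut_equiv_def fg hroot_hreal hdist_hreal
    by (simp add: abs_minus_commute)
qed

lemma cut_equiv_trans:
  assumes "a \<in> hreals" "b \<in> hreals" "d \<in> hreals" "cut_equiv m U a b" "cut_equiv m U b d"
  shows "cut_equiv m U a d"
proof -
  obtain u v where uv: "u \<in> U" "v \<in> U" "hdist (hroot m a) (hroot m b) <\<^sub>\<star> u" "hdist (hroot m b) (hroot m d) <\<^sub>\<star> v"
    using assms(4,5) by (auto simp: cut_equiv_def)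
  obtain p fs Ss where p: "[a, b, d, u, v] = map (hreal p) fs" "[] = map (hcode p) Ss"
    by (rule represent[of "[a, b, d, u, v]" "[]"]) (use assms uv U_hnats hnats_subset in auto)
  then obtain f g h x y where fg: "a = hreal p f" "b = hreal p g" "d = hreal p h" "u = hreal p x" "v = hreal p y"
    by (auto simp: Cons_eq_map_conv)
  have "hdist (hroot m a) (hroot m d) <\<^sub>\<star> u +\<^sub>\<star> v"
    using uv(3,4) unfolding fg hroot_hreal hdist_hreal hless_hreal hadd_hreal
    by eventually_elim linarith
  then show ?thesis using U_add[OF uv(1,2)] by (auto simp: cut_equiv_def)
qed

text \<open>Numbers with the same ceiling differ by less than 1, and 1 lies in \<open>U\<close>. Cut
  classes are therefore unions of blocks.\<close>

lemma ceiling_eq_imp_cut_equiv: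
  assumes "a \<in> hreals" "b \<in> hreals" "hceiling (hroot m a) = hceiling (hroot m b)"
  shows "cut_equiv m U a b"
proof -
  obtain p fs Ss where p: "[a, b] = map (hreal p) fs" "[] = map (hcode p) Ss"
    by (rule represent[of "[a, b]" "[]"]) (use assms in auto)
  then obtain f g where fg: "a = hreal p f" "b = hreal p g" by (auto simp: Cons_eq_map_conv)
  have "hdist (hroot m a) (hroot m b) <\<^sub>\<star> hreal p (\<lambda>_. 1)"
    using assms(3) unfolding fg hroot_hreal hceiling_hreal hdist_hreal hless_hreal hreal_eq_iff
    by eventually_elim (simp, linarith)
  then show ?thesis using one_mem_U by (auto simp: cut_equiv_def)
qed

lemma cut_equiv_refl: "a \<in> hreals \<Longrightarrow> cut_equiv m U a a"
  by (rule ceiling_eq_imp_cut_equiv) auto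

lemma cut_class_eq_iff:
  assumes "a \<in> X" "b \<in> X"
  shows "cut_class k N m U a = cut_class k N m U b \<longleftrightarrow> cut_equiv m U a b"
proof
  assume "cut_class k N m U a = cut_class k N m U b"
  moreover have "b \<in> cut_class k N m U b"
    using assms X_subset cut_equiv_refl by (auto simp: cut_class_def)
  ultimately show "cut_equiv m U a b" by (auto simp: cut_class_def)
next
  assume "cut_equiv m U a b"
  then show "cut_class k N m U a = cut_class k N m U b"
    unfolding cut_class_def using assms X_subset cut_equiv_sym cut_equiv_trans
    by (smt (verit) Collect_cong subset_iff)
qed

lemma root_shift_hreal:
  assumes "c = hreal p \<gamma>"
  shows "root_shift m c (hreal p f) = hreal p (\<lambda>xs. (of_int (root_ceiling m (f xs)) + \<gamma> xs) ^ m)"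
  using assms by (simp add: root_shift_def hroot_hreal hceiling_hreal hadd_hreal hpower_hreal root_ceiling_def)

lemma represent_with_params:
  assumes "set rs \<subseteq> hreals" "A \<in> internals"
  obtains p \<kappa> \<eta> \<gamma> fs S where "params p \<kappa> \<eta>" "c = hreal p \<gamma>" "rs = map (hreal p) fs" "A = hset (hcode p S)"
    "eventually (\<lambda>xs. S xs \<subseteq> std_X \<kappa> \<eta> xs) (type_filter p)"
    "eventually (\<lambda>xs. \<kappa> xs \<in> pos_nats \<and> \<eta> xs \<in> pos_nats \<and> \<gamma> xs \<in> pos_nats) (type_filter p)"
proof -
  obtain p \<kappa> \<eta> fs Ss where p: "params p \<kappa> \<eta>" "c # rs = map (hreal p) fs" "[A] = map (\<lambda>S. hset (hcode p S)) Ss"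
    "eventually (\<lambda>xs. \<forall>S\<in>set Ss. S xs \<subseteq> std_X \<kappa> \<eta> xs) (type_filter p)"
    by (rule params_exist[of "c # rs" "[A]"]) (use assms c_hnats hnats_subset in auto)
  obtain \<gamma> fs' where c': "c = hreal p \<gamma>" "rs = map (hreal p) fs'"
    using p(2) by (auto simp: Cons_eq_map_conv)
  have "eventually (\<lambda>xs. \<gamma> xs \<in> pos_nats) (type_filter p)"
    using c_hnats c' by (simp add: hnats_hreal)
  then have "eventually (\<lambda>xs. \<kappa> xs \<in> pos_nats \<and> \<eta> xs \<in> pos_nats \<and> \<gamma> xs \<in> pos_nats) (type_filter p)"
    using params_pos_nats[OF p(1)] by eventually_elim auto
  then show thesis using that[OF p(1) c'] p(3,4) by (auto simp: Cons_eq_map_conv)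
qed

text \<open>The roots of the shifted points are the two ceilings plus \<open>c\<close>. Their
  difference is that of the ceilings, which rounding enlarges by less than 1, so
  \<open>u + 1\<close> is a bound in the cut.\<close>

lemma cut_equiv_root_shift:
  assumes "a \<in> X" "b \<in> X" "cut_equiv m U a b"
  shows "cut_equiv m U (root_shift m c a) (root_shift m c b)"
proof -
  obtain u where u: "u \<in> U" "hdist (hroot m a) (hroot m b) <\<^sub>\<star> u"
    using assms(3) by (auto simp: cut_equiv_def)
  obtain p \<kappa> \<eta> \<gamma> fs S where p: "params p \<kappa> \<eta>" "c = hreal p \<gamma>" "[a, b, u] = map (hreal p) fs" "X = hset (hcode p S)"
    "eventually (\<lambda>xs. S xs \<subseteq> std_X \<kappa> \<eta> xs) (type_filter p)"
    "eventually (\<lambda>xs. \<kappa> xs \<in> pos_nats \<and> \<eta> xs \<in> pos_nats \<and> \<gamma> xs \<in> pos_nats) (type_filter p)"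
    by (rule represent_with_params[of "[a, b, u]" X])
       (use assms X_subset X_internals u U_hnats hnats_subset in auto)
  then obtain f g v where fg: "a = hreal p f" "b = hreal p g" "u = hreal p v" by (auto simp: Cons_eq_map_conv)
  have ab: "eventually (\<lambda>xs. f xs \<in> std_X \<kappa> \<eta> xs) (type_filter p)"
    "eventually (\<lambda>xs. g xs \<in> std_X \<kappa> \<eta> xs) (type_filter p)"
    using assms(1,2) hreal_mem_X_iff[OF p(1)] fg by simp_all
  have "hdist (hroot m (root_shift m c a)) (hroot m (root_shift m c b)) <\<^sub>\<star> u +\<^sub>\<star> hreal p (\<lambda>_. 1)"
    using u(2) p(6) ab unfolding fg root_shift_hreal[OF p(2)] hroot_hreal hdist_hreal hless_hreal hadd_hreal
  proof eventually_elim
    case (elim xs)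
    have "f xs \<ge> 1" "g xs \<ge> 1" "\<gamma> xs \<ge> 1" using elim by (auto simp: std_interval_def pos_nats_def)
    then have "of_int (root_ceiling m (f xs)) + \<gamma> xs \<ge> 0" "of_int (root_ceiling m (g xs)) + \<gamma> xs \<ge> 0"
      using root_ceiling_pos[OF m, of "f xs"] root_ceiling_pos[OF m, of "g xs"] by linarith+
    then have "root m ((of_int (root_ceiling m (f xs)) + \<gamma> xs) ^ m) = of_int (root_ceiling m (f xs)) + \<gamma> xs"
      "root m ((of_int (root_ceiling m (g xs)) + \<gamma> xs) ^ m) = of_int (root_ceiling m (g xs)) + \<gamma> xs"
      using m by (simp_all add: real_root_power_cancel)
    moreover have "\<bar>real_of_int (root_ceiling m (f xs)) - real_of_int (root_ceiling m (g xs))\<bar> < v xs + 1"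
      using elim(1) unfolding root_ceiling_def by linarith
    ultimately show ?case by simp
  qed
  moreover have "u +\<^sub>\<star> hreal p (\<lambda>_. 1) \<in> U" using U_add u(1) one_mem_U by simp
  ultimately show ?thesis by (auto simp: cut_equiv_def)
qed

section \<open>Hulls and shift preimages of internal sets\<close>

definition saturation :: "'a set \<Rightarrow> 'a set" where
  "saturation D = {a \<in> X. \<exists>d\<in>D. hceiling (hroot m a) = hceiling (hroot m d)}"

definition shift_vimage :: "'a set \<Rightarrow> 'a set" where
  "shift_vimage D = {a \<in> X. root_shift m c a \<in> D}"

text \<open>A given \<open>d\<close> is adjoined to the tuple to read its conditions pointwise; in
  the other direction, a pointwise choice of \<open>d\<close> is itself a value and hence an element
  of \<open>D\<close>.\<close>

lemma saturation_eq_hset: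
  assumes p: "params p \<kappa> \<eta>" and D: "D = hset (hcode p S)"
  shows "saturation D = hset (hcode p
    (\<lambda>xs. {a \<in> std_X \<kappa> \<eta> xs. \<exists>d\<in>S xs. root_ceiling m a = root_ceiling m d}))" (is "_ = hset (hcode p ?T)")
proof (rule set_eqI)
  fix a
  show "a \<in> saturation D \<longleftrightarrow> a \<in> hset (hcode p ?T)"
  proof (cases "a \<in> hreals")
    case True
    define \<alpha> where "\<alpha> = (\<lambda>xs. real_of_univ (hd xs))"
    have a: "a = hreal (a # p) \<alpha>" using represent_Cons[OF True] by (simp add: \<alpha>_def)
    note q = params_Cons[OF p, of a]
    show ?thesis
    proof
      assume "a \<in> saturation D"
      then obtain d where d: "a \<in> X" "d \<in> D" "hceiling (hroot m a) = hceiling (hroot m d)"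
        by (auto simp: saturation_def)
      define \<delta> where "\<delta> = (\<lambda>xs. real_of_univ (hd xs))"
      have dr: "d = hreal (d # a # p) \<delta>"
        using represent_Cons[of d "a # p"] d(2) D hset_subset by (auto simp: \<delta>_def)
      note r = params_Cons[OF q, of d]
      have ar: "a = hreal (d # a # p) (\<lambda>xs. \<alpha> (tl xs))" using a hreal_Cons[of d "a # p" \<alpha>] by simp
      have D': "D = hset (hcode (d # a # p) (\<lambda>xs. S (tl (tl xs))))"
        using D hcode_Cons[of d "a # p" "\<lambda>xs. S (tl xs)"] hcode_Cons[of a p S] by simp
      have T': "hcode p ?T = hcode (d # a # p) (\<lambda>xs. ?T (tl (tl xs)))"
        using hcode_Cons[of d "a # p" "\<lambda>xs. ?T (tl xs)"] hcode_Cons[of a p ?T] by simp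
      have "eventually (\<lambda>xs. \<alpha> (tl xs) \<in> std_X \<kappa> \<eta> (tl (tl xs))) (type_filter (d # a # p))"
        using d(1) hreal_mem_X_iff[OF r, of "\<lambda>xs. \<alpha> (tl xs)"] ar by simp
      moreover have "eventually (\<lambda>xs. \<delta> xs \<in> S (tl (tl xs))) (type_filter (d # a # p))"
        using d(2) unfolding D' by (subst (asm) dr) (simp add: mem_hset_hreal)
      moreover have "eventually (\<lambda>xs. root_ceiling m (\<alpha> (tl xs)) = root_ceiling m (\<delta> xs)) (type_filter (d # a # p))"
        using d(3) unfolding root_ceiling_def
        by (subst (asm) ar, subst (asm) dr) (simp add: hroot_hreal hceiling_hreal hreal_eq_iff)
      ultimately have "eventually (\<lambda>xs. \<alpha> (tl xs) \<in> ?T (tl (tl xs))) (type_filter (d # a # p))"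
        by eventually_elim auto
      then show "a \<in> hset (hcode p ?T)"
        unfolding T' by (subst ar) (simp add: mem_hset_hreal)
    next
      assume "a \<in> hset (hcode p ?T)"
      then have ev: "eventually (\<lambda>xs. \<alpha> xs \<in> ?T (tl xs)) (type_filter (a # p))"
        by (simp add: mem_hset_iff \<alpha>_def)
      define \<delta> where "\<delta> = (\<lambda>xs. SOME d. d \<in> S (tl xs) \<and> root_ceiling m (\<alpha> xs) = root_ceiling m d)"
      have \<delta>: "eventually (\<lambda>xs. \<alpha> xs \<in> std_X \<kappa> \<eta> (tl xs) \<and> \<delta> xs \<in> S (tl xs) \<and>
          root_ceiling m (\<alpha> xs) = root_ceiling m (\<delta> xs)) (type_filter (a # p))"
        using ev
      proof eventually_elim
        case (elim xs)
        then have "\<exists>d. d \<in> S (tl xs) \<and> root_ceiling m (\<alpha> xs) = root_ceiling m d" by auto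
        then have "\<delta> xs \<in> S (tl xs) \<and> root_ceiling m (\<alpha> xs) = root_ceiling m (\<delta> xs)"
          unfolding \<delta>_def by (rule someI_ex)
        then show ?case using elim by auto
      qed
      have "hreal (a # p) \<alpha> \<in> X"
        using \<delta> by (subst hreal_mem_X_iff[OF q]) (auto elim!: eventually_mono)
      moreover have "hreal (a # p) \<delta> \<in> D"
        using \<delta> unfolding D hcode_Cons[of a p S, symmetric] mem_hset_hreal by (auto elim!: eventually_mono)
      moreover have "hceiling (hroot m (hreal (a # p) \<alpha>)) = hceiling (hroot m (hreal (a # p) \<delta>))"
        using \<delta> unfolding hroot_hreal hceiling_hreal hreal_eq_iff root_ceiling_def
        by (auto elim!: eventually_mono)
      ultimately show "a \<in> saturation D" using a unfolding saturation_def by auto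
    qed
  qed (use X_subset hset_subset in \<open>auto simp: saturation_def\<close>)
qed

lemma saturation_internals:
  assumes "D \<in> internals"
  shows "saturation D \<in> internals"
proof -
  obtain p \<kappa> \<eta> \<gamma> fs S where p: "params p \<kappa> \<eta>" "c = hreal p \<gamma>" "[] = map (hreal p) fs" "D = hset (hcode p S)"
    "eventually (\<lambda>xs. S xs \<subseteq> std_X \<kappa> \<eta> xs) (type_filter p)"
    "eventually (\<lambda>xs. \<kappa> xs \<in> pos_nats \<and> \<eta> xs \<in> pos_nats \<and> \<gamma> xs \<in> pos_nats) (type_filter p)"
    by (rule represent_with_params[of "[]" D]) (use assms in auto)
  show ?thesis unfolding saturation_eq_hset[OF p(1,4)] by (rule hset_mem_internals[OF p(1)]) auto
qed

lemma shift_vimage_eq_hset: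
  assumes p: "params p \<kappa> \<eta>" "c = hreal p \<gamma>" and D: "D = hset (hcode p S)"
  shows "shift_vimage D = hset (hcode p (\<lambda>xs. shift_preimage m (\<kappa> xs) (\<eta> xs) (\<gamma> xs) (S xs)))"
    (is "_ = hset (hcode p ?T)")
proof (rule set_eqI)
  fix a
  show "a \<in> shift_vimage D \<longleftrightarrow> a \<in> hset (hcode p ?T)"
  proof (cases "a \<in> hreals")
    case True
    define \<alpha> where "\<alpha> = (\<lambda>xs. real_of_univ (hd xs))"
    have a: "a = hreal (a # p) \<alpha>" using represent_Cons[OF True] by (simp add: \<alpha>_def)
    note q = params_Cons[OF p(1), of a]
    have c': "c = hreal (a # p) (\<lambda>xs. \<gamma> (tl xs))" using p(2) hreal_Cons[of a p \<gamma>] by simp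
    have D': "D = hset (hcode (a # p) (\<lambda>xs. S (tl xs)))" using D hcode_Cons[of a p S] by simp
    have "hreal (a # p) \<alpha> \<in> shift_vimage D \<longleftrightarrow> eventually (\<lambda>xs. \<alpha> xs \<in> ?T (tl xs)) (type_filter (a # p))"
      unfolding shift_vimage_def mem_Collect_eq root_shift_hreal[OF c'] hreal_mem_X_iff[OF q] D' mem_hset_hreal
      by (simp add: shift_preimage_def eventually_conj_iff)
    also have "\<dots> \<longleftrightarrow> a \<in> hset (hcode p ?T)" using True by (simp add: mem_hset_iff \<alpha>_def)
    finally show ?thesis using a by simp
  qed (use X_subset hset_subset in \<open>auto simp: shift_vimage_def\<close>)
qed

text \<open>After division by \<open>m * N\<close> the difference is at most
  \<open>2 * c / N + 2 / N\<close>, and both terms are infinitesimal.\<close>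

lemma density_diff_zero:
  assumes p: "params p \<kappa> \<eta>" "c = hreal p \<gamma>"
    and S: "eventually (\<lambda>xs. S xs \<subseteq> std_X \<kappa> \<eta> xs) (type_filter p)"
    and T: "eventually (\<lambda>xs. T xs \<subseteq> std_X \<kappa> \<eta> xs) (type_filter p)"
    and le: "eventually (\<lambda>xs. \<bar>(\<Sum>a\<in>S xs. weight m a) - (\<Sum>a\<in>T xs. weight m a)\<bar> \<le> real m * (2 * \<gamma> xs + 2)) (type_filter p)"
  shows "power_density N m (hset (hcode p S)) = power_density N m (hset (hcode p T))"
proof -
  have "((\<lambda>xs. 1 / \<eta> xs) \<longlongrightarrow> 0) (type_filter p)"
    using params_at_top[OF p(1)] by (intro tendsto_divide_0[OF tendsto_const] filterlim_at_top_imp_at_infinity)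
  then have lim: "((\<lambda>xs. 2 * (\<gamma> xs / \<eta> xs) + 2 * (1 / \<eta> xs)) \<longlongrightarrow> 2 * 0 + 2 * 0) (type_filter p)"
    by (intro tendsto_intros c_over_N_tendsto[OF p])
  have "((\<lambda>xs. std_density m (\<eta> xs) (S xs) - std_density m (\<eta> xs) (T xs)) \<longlongrightarrow> 0) (type_filter p)"
  proof (rule Lim_null_comparison[OF _ lim[simplified]])
    show "eventually (\<lambda>xs. norm (std_density m (\<eta> xs) (S xs) - std_density m (\<eta> xs) (T xs))
        \<le> 2 * (\<gamma> xs) / \<eta> xs + 2 / \<eta> xs) (type_filter p)"
      using le params_pos_nats[OF p(1)]
    proof eventually_elim
      case (elim xs)
      have pos: "real m > 0" "\<eta> xs > 0" using m elim by (auto simp: pos_nats_def)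
      have "std_density m (\<eta> xs) (S xs) - std_density m (\<eta> xs) (T xs)
          = ((\<Sum>a\<in>S xs. weight m a) - (\<Sum>a\<in>T xs. weight m a)) / (real m * \<eta> xs)"
        by (simp add: std_density_def diff_divide_distrib)
      then have "\<bar>std_density m (\<eta> xs) (S xs) - std_density m (\<eta> xs) (T xs)\<bar>
          = \<bar>(\<Sum>a\<in>S xs. weight m a) - (\<Sum>a\<in>T xs. weight m a)\<bar> / (real m * \<eta> xs)"
        using pos by (simp add: abs_divide)
      also have "\<dots> \<le> real m * (2 * \<gamma> xs + 2) / (real m * \<eta> xs)"
        using elim pos by (intro divide_right_mono) auto
      also have "\<dots> = 2 * (\<gamma> xs) / \<eta> xs + 2 / \<eta> xs" using pos by (simp add: add_divide_distrib)
      finally show ?case by simp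
    qed
  qed
  moreover have "((\<lambda>xs. std_density m (\<eta> xs) (S xs) - std_density m (\<eta> xs) (T xs)) \<longlongrightarrow>
      power_density N m (hset (hcode p S)) - power_density N m (hset (hcode p T))) (type_filter p)"
    by (intro tendsto_diff density_tendsto[OF p(1)] S T)
  ultimately show ?thesis using tendsto_unique[of "type_filter p"] by fastforce
qed

text \<open>The hypothesis on \<open>saturation D\<close> says that the representing standard sets
  are eventually unions of blocks, for which \<open>sum_weight_shift_preimage\<close> gives the
  required bound.\<close>

lemma shift_vimage_internals:
  assumes "D \<in> internals"
  shows "shift_vimage D \<in> internals"
    and "saturation D \<subseteq> D \<Longrightarrow> power_density N m (shift_vimage D) = power_density N m D"
proof -
  obtain p \<kappa> \<eta> \<gamma> fs S where p: "params p \<kappa> \<eta>" "c = hreal p \<gamma>" "[] = map (hreal p) fs" "D = hset (hcode p S)"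
    "eventually (\<lambda>xs. S xs \<subseteq> std_X \<kappa> \<eta> xs) (type_filter p)"
    "eventually (\<lambda>xs. \<kappa> xs \<in> pos_nats \<and> \<eta> xs \<in> pos_nats \<and> \<gamma> xs \<in> pos_nats) (type_filter p)"
    by (rule represent_with_params[of "[]" D]) (use assms in auto)
  let ?T = "\<lambda>xs. shift_preimage m (\<kappa> xs) (\<eta> xs) (\<gamma> xs) (S xs)"
  have T: "eventually (\<lambda>xs. ?T xs \<subseteq> std_X \<kappa> \<eta> xs) (type_filter p)"
    by (auto simp: shift_preimage_def)
  note eq = shift_vimage_eq_hset[OF p(1,2,4)]
  show "shift_vimage D \<in> internals" unfolding eq by (rule hset_mem_internals[OF p(1) T])
  assume "saturation D \<subseteq> D"
  then have "eventually (\<lambda>xs. {a \<in> std_X \<kappa> \<eta> xs. \<exists>d\<in>S xs. root_ceiling m a = root_ceiling m d} \<subseteq> S xs) (type_filter p)"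
    unfolding p(4) saturation_eq_hset[OF p(1) refl] hset_hcode_subset_iff .
  then have sat: "eventually (\<lambda>xs. saturated m (\<kappa> xs) (\<eta> xs) (S xs)) (type_filter p)"
    using p(5) by eventually_elim (auto simp: saturated_def)
  show "power_density N m (shift_vimage D) = power_density N m D"
    unfolding eq unfolding p(4)
  proof (rule density_diff_zero[OF p(1,2) T p(5)])
    show "eventually (\<lambda>xs. \<bar>(\<Sum>a\<in>?T xs. weight m a) - (\<Sum>a\<in>S xs. weight m a)\<bar> \<le> real m * (2 * \<gamma> xs + 2)) (type_filter p)"
      using sat p(6)
    proof eventually_elim
      case (elim xs)
      obtain n where n: "n \<ge> 1" "\<eta> xs = of_int n" using elim pos_nats_int by blast
      obtain c' where c': "c' \<ge> 1" "\<gamma> xs = of_int c'" using elim pos_nats_int by blast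
      have "\<bar>(\<Sum>a\<in>?T xs. weight m a) - (\<Sum>a\<in>S xs. weight m a)\<bar> \<le> real m * (\<gamma> xs + 2)"
        using sum_weight_shift_preimage[OF m _ n(2,1) c'(2,1)] elim by blast
      also have "\<dots> \<le> real m * (2 * \<gamma> xs + 2)" using c' by (intro mult_left_mono) auto
      finally show ?case .
    qed
  qed
qed

text \<open>If the shift of \<open>b\<close> leaves the interval, the block of \<open>b\<close> is
  among the last \<open>c\<close> ones. The root of an equivalent \<open>a\<close> is within some
  \<open>u\<close> below \<open>c\<close> of that of \<open>b\<close>, so the block of
  \<open>a\<close> is among the last \<open>2 * c + 1\<close>, whose total density is zero.\<close>

lemma right_end_null:
  "\<exists>Z\<in>internals. power_density N m Z = 0 \<and>
    (\<forall>a\<in>X. \<forall>b\<in>X. cut_equiv m U a b \<longrightarrow> root_shift m c b \<notin> X \<longrightarrow> a \<in> Z)"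
proof -
  obtain p \<kappa> \<eta> \<gamma> fs S where p: "params p \<kappa> \<eta>" "c = hreal p \<gamma>" "[] = map (hreal p) fs" "X = hset (hcode p S)"
    "eventually (\<lambda>xs. S xs \<subseteq> std_X \<kappa> \<eta> xs) (type_filter p)"
    "eventually (\<lambda>xs. \<kappa> xs \<in> pos_nats \<and> \<eta> xs \<in> pos_nats \<and> \<gamma> xs \<in> pos_nats) (type_filter p)"
    by (rule represent_with_params[of "[]" X]) (use X_internals in auto)
  define T where "T = (\<lambda>xs. {a. a \<in> std_X \<kappa> \<eta> xs \<and>
      of_int (root_ceiling m a) + 2 * \<gamma> xs + 1 > of_int (root_ceiling m (\<kappa> xs)) + \<eta> xs})"
  let ?Z = "hset (hcode p T)"
  have T: "eventually (\<lambda>xs. T xs \<subseteq> std_X \<kappa> \<eta> xs) (type_filter p)" by (auto simp: T_def)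
  have Z: "?Z \<in> internals" by (rule hset_mem_internals[OF p(1) T])
  have "power_density N m ?Z = power_density N m (hset (hcode p (\<lambda>_. {})))"
  proof (rule density_diff_zero[OF p(1,2) T])
    show "eventually (\<lambda>xs. \<bar>(\<Sum>a\<in>T xs. weight m a) - (\<Sum>a\<in>{}. weight m a)\<bar> \<le> real m * (2 * \<gamma> xs + 2)) (type_filter p)"
      using p(6)
    proof eventually_elim
      case (elim xs)
      obtain n where n: "n \<ge> 1" "\<eta> xs = of_int n" using elim pos_nats_int by blast
      obtain c' where c': "c' \<ge> 1" "\<gamma> xs = of_int c'" using elim pos_nats_int by blast
      have "(\<Sum>a\<in>T xs. weight m a) \<le> real m * (2 * \<gamma> xs + 1)"
        using sum_weight_right_end[OF m _ n(2,1) c'(2,1)] elim unfolding T_def by blast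
      also have "\<dots> \<le> real m * (2 * \<gamma> xs + 2)" using c' by (intro mult_left_mono) auto
      finally show ?case by (simp add: sum_nonneg)
    qed
  qed simp
  also have "\<dots> = 0"
    using density_additive[of "{}" "{}"] Diff_internals[OF X_internals X_internals] by (simp add: hset_empty)
  finally have Z0: "power_density N m ?Z = 0" .
  \<comment> \<open>\<open>?Z\<close> is fixed before \<open>a\<close>, \<open>b\<close> and
    \<open>u\<close> are given, so these are adjoined to the tuple.\<close>
  have "a \<in> ?Z" if ab: "a \<in> X" "b \<in> X" "cut_equiv m U a b" "root_shift m c b \<notin> X" for a b
  proof -
    obtain u where u: "u \<in> U" "hdist (hroot m a) (hroot m b) <\<^sub>\<star> u"
      using ab(3) by (auto simp: cut_equiv_def)
    define \<beta> \<alpha> where "\<beta> = (\<lambda>xs. real_of_univ (hd xs))" and "\<alpha> = (\<lambda>xs. real_of_univ (hd xs))"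
    define v where "v = (\<lambda>xs. real_of_univ (hd xs))"
    let ?q = "u # b # a # p"
    have ur: "u = hreal ?q v" using represent_Cons[of u "b # a # p"] u(1) U_hnats hnats_subset by (auto simp: v_def)
    have "b = hreal (b # a # p) \<beta>" using represent_Cons[of b "a # p"] ab(2) X_subset by (auto simp: \<beta>_def)
    then have br: "b = hreal ?q (\<lambda>xs. \<beta> (tl xs))" using hreal_Cons[of u "b # a # p" \<beta>] by simp
    have "a = hreal (a # p) \<alpha>" using represent_Cons[of a p] ab(1) X_subset by (auto simp: \<alpha>_def)
    then have ar: "a = hreal ?q (\<lambda>xs. \<alpha> (tl (tl xs)))"
      using hreal_Cons[of u "b # a # p" "\<lambda>xs. \<alpha> (tl xs)"] hreal_Cons[of b "a # p" \<alpha>] by simp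
    have q: "params ?q (\<lambda>xs. \<kappa> (tl (tl (tl xs)))) (\<lambda>xs. \<eta> (tl (tl (tl xs))))"
      using params_Cons[OF params_Cons[OF params_Cons[OF p(1), of a], of b], of u] .
    have cr: "c = hreal ?q (\<lambda>xs. \<gamma> (tl (tl (tl xs))))"
      using p(2) hreal_Cons[of u "b # a # p" "\<lambda>xs. \<gamma> (tl (tl xs))"] hreal_Cons[of b "a # p" "\<lambda>xs. \<gamma> (tl xs)"]
        hreal_Cons[of a p \<gamma>] by simp
    have Tr: "hcode p T = hcode ?q (\<lambda>xs. T (tl (tl (tl xs))))"
      using hcode_Cons[of u "b # a # p" "\<lambda>xs. T (tl (tl xs))"] hcode_Cons[of b "a # p" "\<lambda>xs. T (tl xs)"]
        hcode_Cons[of a p T] by simp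
    let ?k = "\<lambda>xs. \<kappa> (tl (tl (tl xs)))" and ?n = "\<lambda>xs. \<eta> (tl (tl (tl xs)))"
    let ?c = "\<lambda>xs. \<gamma> (tl (tl (tl xs)))" and ?a = "\<lambda>xs. \<alpha> (tl (tl xs))" and ?b = "\<lambda>xs. \<beta> (tl xs)"
    have 1: "eventually (\<lambda>xs. ?a xs \<in> std_X ?k ?n xs) (type_filter ?q)"
      using ab(1) hreal_mem_X_iff[OF q, of ?a] ar by simp
    have 2: "eventually (\<lambda>xs. ?b xs \<in> std_X ?k ?n xs) (type_filter ?q)"
      using ab(2) hreal_mem_X_iff[OF q, of ?b] br by simp
    have 3: "eventually (\<lambda>xs. (of_int (root_ceiling m (?b xs)) + ?c xs) ^ m \<notin> std_X ?k ?n xs) (type_filter ?q)"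
      using ab(4) hreal_mem_X_iff[OF q] root_shift_hreal[OF cr, of ?b] br by (simp add: type_filter_ultra)
    have 4: "eventually (\<lambda>xs. \<bar>root m (?a xs) - root m (?b xs)\<bar> < v xs) (type_filter ?q)"
      using u(2) by (subst (asm) ar, subst (asm) br, subst (asm) ur) (simp add: hroot_hreal hdist_hreal hless_hreal)
    have 5: "eventually (\<lambda>xs. v xs < ?c xs) (type_filter ?q)"
      using U_less_c[OF u(1)] by (subst (asm) ur, subst (asm) cr) (simp add: hless_hreal)
    have 6: "eventually (\<lambda>xs. ?c xs \<in> pos_nats) (type_filter ?q)"
      using c_hnats by (subst (asm) cr) (simp add: hnats_hreal)
    have "eventually (\<lambda>xs. ?a xs \<in> T (tl (tl (tl xs)))) (type_filter ?q)"
      using 1 2 3 4 5 6 params_pos_nats[OF q]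
    proof eventually_elim
      case (elim xs)
      obtain n where n: "n \<ge> 1" "?n xs = of_int n" using elim pos_nats_int by blast
      obtain c' where c': "c' \<ge> 1" "?c xs = of_int c'" using elim pos_nats_int by blast
      have "\<not> root_ceiling m (?b xs) + c' \<le> root_ceiling m (?k xs) + n"
        using shift_mem_std_interval_iff[OF m _ n(2,1) c'(2,1) elim(2)] elim by blast
      then have "real_of_int (root_ceiling m (?b xs)) + ?c xs > of_int (root_ceiling m (?k xs)) + ?n xs"
        unfolding n c' by linarith
      moreover have "real_of_int (root_ceiling m (?b xs)) < root m (?b xs) + 1"
        "root m (?a xs) \<le> real_of_int (root_ceiling m (?a xs))"
        unfolding root_ceiling_def by linarith+
      ultimately have "of_int (root_ceiling m (?a xs)) + 2 * ?c xs + 1 > of_int (root_ceiling m (?k xs)) + ?n xs"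
        using elim(4,5) by linarith
      then show ?case using elim(1) by (simp add: T_def)
    qed
    then show ?thesis unfolding Tr by (subst ar) (simp add: mem_hset_hreal)
  qed
  then show ?thesis using Z Z0 by blast
qed

lemma saturation_idem: "saturation (saturation D) \<subseteq> saturation D"
  by (auto simp: saturation_def)

text \<open>The complement of a union of blocks is again one; this makes kernels eligible for
  \<open>shift_vimage_internals\<close>.\<close>

lemma saturation_Diff: "saturation (X - saturation D) \<subseteq> X - saturation D"
  by (auto simp: saturation_def) metis

text \<open>\<open>B\<close> is a union of cut classes, hence of blocks, so hulls of its internal
  subsets stay inside it and kernels of its internal supersets still contain it. The null set
  \<open>Z\<close> absorbs the points at which \<open>B'\<close> may differ from the shift
  preimage.\<close>

lemma shift_vimage_loeb:
  assumes B: "B \<in> sets (loeb_measure k N m)"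
    and B_sat: "\<And>a b. a \<in> B \<Longrightarrow> b \<in> X \<Longrightarrow> cut_equiv m U a b \<Longrightarrow> b \<in> B"
    and Z: "Z \<in> internals" "power_density N m Z = 0"
    and B': "B' \<subseteq> X" "\<And>a. a \<in> X \<Longrightarrow> a \<notin> Z \<Longrightarrow> a \<in> B' \<longleftrightarrow> root_shift m c a \<in> B"
  shows "B' \<in> sets (loeb_measure k N m)"
    and "measure (loeb_measure k N m) B' = measure (loeb_measure k N m) B"
proof -
  let ?r = "measure (loeb_measure k N m) B"
  have BX: "B \<subseteq> X" using sets.sets_into_space[OF B] by simp
  have sat: "b \<in> B" if "a \<in> B" "b \<in> X" "hceiling (hroot m b) = hceiling (hroot m a)" for a b
    using that BX X_subset by (intro B_sat[of a b] ceiling_eq_imp_cut_equiv) auto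
  have inner: "\<exists>D\<in>internals. D \<subseteq> B' \<and> ?r - e < power_density N m D" if "e > 0" for e
  proof -
    obtain D0 where D0: "D0 \<in> internals" "D0 \<subseteq> B" "power_density N m D0 > ?r - e"
      using loeb_inner_approx[OF B \<open>e > 0\<close>] by blast
    let ?D = "saturation D0"
    have D: "?D \<in> internals" by (rule saturation_internals[OF D0(1)])
    have "D0 \<subseteq> ?D" using D0 BX by (auto simp: saturation_def)
    then have "?r - e < power_density N m ?D" using density_mono[OF D0(1) D] D0(3) by linarith
    also have "\<dots> = power_density N m (shift_vimage ?D)"
      using shift_vimage_internals(2)[OF D saturation_idem] by simp
    also have "\<dots> = power_density N m (shift_vimage ?D - Z)"
      using density_null(1)[OF shift_vimage_internals(1)[OF D] Z] by simp
    finally have "?r - e < power_density N m (shift_vimage ?D - Z)" .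
    moreover have "?D \<subseteq> B" using sat D0(2) by (auto simp: saturation_def)
    then have "shift_vimage ?D - Z \<subseteq> B'" using B'(2) by (auto simp: shift_vimage_def)
    ultimately show ?thesis using Diff_internals[OF shift_vimage_internals(1)[OF D] Z(1)] by blast
  qed
  have outer: "\<exists>F\<in>internals. B' \<subseteq> F \<and> power_density N m F < ?r + e" if "e > 0" for e
  proof -
    obtain F0 where F0: "F0 \<in> internals" "B \<subseteq> F0" "power_density N m F0 < ?r + e"
      using loeb_outer_approx[OF B \<open>e > 0\<close>] by blast
    \<comment> \<open>The kernel of \<open>F0\<close>, the largest union of blocks contained in
      it.\<close>
    let ?F = "X - saturation (X - F0)"
    have F: "?F \<in> internals" using F0(1) X_internals by (intro Diff_internals saturation_internals)
    have "?F \<subseteq> F0" by (auto simp: saturation_def)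
    then have "power_density N m ?F < ?r + e" using density_mono[OF F F0(1)] F0(3) by linarith
    then have "power_density N m (shift_vimage ?F \<union> Z) < ?r + e"
      using shift_vimage_internals(2)[OF F saturation_Diff] density_null(2)[OF shift_vimage_internals(1)[OF F] Z]
      by simp
    moreover have "B \<subseteq> ?F"
    proof
      fix b assume b: "b \<in> B"
      have "b \<notin> saturation (X - F0)"
      proof
        assume "b \<in> saturation (X - F0)"
        then obtain d where "d \<in> X" "d \<notin> F0" "hceiling (hroot m b) = hceiling (hroot m d)"
          by (auto simp: saturation_def)
        then show False using sat[OF b, of d] F0(2) by auto
      qed
      then show "b \<in> ?F" using b BX by blast
    qed
    then have "B' \<subseteq> shift_vimage ?F \<union> Z" using B' unfolding shift_vimage_def by blast
    ultimately show ?thesis using Un_internals[OF shift_vimage_internals(1)[OF F] Z(1)] by blast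
  qed
  show "B' \<in> sets (loeb_measure k N m)" "measure (loeb_measure k N m) B' = ?r"
    using loeb_sandwich[of B' ?r] inner outer by blast+
qed

section \<open>The measure on the quotient\<close>

abbreviation cut_preimage :: "'a set set \<Rightarrow> 'a set" where
  "cut_preimage E \<equiv> cut_class k N m U -` E \<inter> X"

definition cut_sets :: "'a set set set" where
  "cut_sets = {E. E \<subseteq> cut_quotient k N m U \<and> cut_preimage E \<in> sets (loeb_measure k N m)}"

text \<open>Preimages commute with complements and countable unions. Being a sigma-algebra already,
  the family is not enlarged by \<open>measure_of\<close>.\<close>

lemma sigma_algebra_cut_sets: "sigma_algebra (cut_quotient k N m U) cut_sets"
  unfolding sigma_algebra_iff2
proof (intro conjI ballI allI impI)
  show "cut_sets \<subseteq> Pow (cut_quotient k N m U)" "{} \<in> cut_sets" by (auto simp: cut_sets_def)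
  show "cut_quotient k N m U - E \<in> cut_sets" if "E \<in> cut_sets" for E
  proof -
    have "cut_preimage (cut_quotient k N m U - E) = X - cut_preimage E" by (auto simp: cut_quotient_def)
    then show ?thesis using that sets.compl_sets[of "cut_preimage E" "loeb_measure k N m"]
      by (auto simp: cut_sets_def)
  qed
  show "(\<Union>i::nat. A i) \<in> cut_sets" if "range A \<subseteq> cut_sets" for A
  proof -
    have "cut_preimage (A i) \<in> sets (loeb_measure k N m)" for i
      using that by (auto simp: cut_sets_def)
    then have "(\<Union>i. cut_preimage (A i)) \<in> sets (loeb_measure k N m)"
      by (intro sets.countable_UN) blast
    moreover have "cut_preimage (\<Union>i. A i) = (\<Union>i. cut_preimage (A i))" by auto
    ultimately have "cut_preimage (\<Union>i. A i) \<in> sets (loeb_measure k N m)" by (simp only:)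
    then show ?thesis using that unfolding cut_sets_def by blast
  qed
qed

lemma cut_measure_eq: "cut_measure k N m U =
    measure_of (cut_quotient k N m U) cut_sets (\<lambda>E. emeasure (loeb_measure k N m) (cut_preimage E))"
  by (simp add: cut_measure_def cut_sets_def)

lemma sets_cut_measure: "sets (cut_measure k N m U) = cut_sets"
  unfolding cut_measure_eq by (rule sigma_algebra.sets_measure_of_eq[OF sigma_algebra_cut_sets])

lemma space_cut_measure: "space (cut_measure k N m U) = cut_quotient k N m U"
  unfolding cut_measure_eq by (rule sigma_algebra.space_measure_of_eq[OF sigma_algebra_cut_sets])

text \<open>\<open>measure_of\<close> keeps a set function only if it is a measure; here countable
  additivity is inherited because disjoint sets of classes have disjoint preimages.\<close>

lemma emeasure_cut_measure:
  assumes "E \<in> cut_sets"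
  shows "emeasure (cut_measure k N m U) E = emeasure (loeb_measure k N m) (cut_preimage E)"
  unfolding cut_measure_eq
proof (rule emeasure_measure_of_sigma[OF sigma_algebra_cut_sets _ _ assms])
  show "positive cut_sets (\<lambda>E. emeasure (loeb_measure k N m) (cut_preimage E))"
    by (simp add: positive_def)
  show "countably_additive cut_sets (\<lambda>E. emeasure (loeb_measure k N m) (cut_preimage E))"
  proof (rule countably_additiveI)
    fix A :: "nat \<Rightarrow> 'a set set"
    assume A: "range A \<subseteq> cut_sets" "disjoint_family A"
    have "(\<Sum>i. emeasure (loeb_measure k N m) (cut_preimage (A i))) =
        emeasure (loeb_measure k N m) (\<Union>i. cut_preimage (A i))"
    proof (rule suminf_emeasure)
      show "range (\<lambda>i. cut_preimage (A i)) \<subseteq> sets (loeb_measure k N m)"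
        using A(1) by (auto simp: cut_sets_def)
      show "disjoint_family (\<lambda>i. cut_preimage (A i))"
        using A(2) unfolding disjoint_family_on_def by blast
    qed
    also have "(\<Union>i. cut_preimage (A i)) = cut_preimage (\<Union>i. A i)" by auto
    finally show "(\<Sum>i. emeasure (loeb_measure k N m) (cut_preimage (A i))) =
        emeasure (loeb_measure k N m) (cut_preimage (\<Union>i. A i))" .
  qed
qed

text \<open>A class with some representative shifted out of the interval lies entirely in the null
  set \<open>Z\<close>; completeness of the Loeb measure makes the set of these classes measurable
  and null.\<close>

lemma root_shift_AE_defined:
  "AE g in cut_measure k N m U. \<forall>a\<in>g. root_shift m c a \<in> X"
proof -
  obtain Z where Z: "Z \<in> internals" "power_density N m Z = 0"
    "\<And>a b. a \<in> X \<Longrightarrow> b \<in> X \<Longrightarrow> cut_equiv m U a b \<Longrightarrow> root_shift m c b \<notin> X \<Longrightarrow> a \<in> Z"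
    using right_end_null by blast
  let ?E = "{g \<in> cut_quotient k N m U. \<exists>a\<in>g. root_shift m c a \<notin> X}"
  have Z0: "Z \<in> null_sets (loeb_measure k N m)"
    using Z(1,2) by (simp add: null_sets_def loeb_measure_eq emeasure_internal)
  have "cut_preimage ?E \<subseteq> Z" using Z(3) by (auto simp: cut_class_def)
  then have null: "cut_preimage ?E \<in> null_sets (loeb_measure k N m)"
    using Z0 unfolding loeb_measure_eq by (rule completion.complete2)
  then have "?E \<in> cut_sets" by (auto simp: cut_sets_def)
  then have "?E \<in> null_sets (cut_measure k N m U)"
    using null emeasure_cut_measure[of ?E] by (auto simp: null_sets_def sets_cut_measure)
  then show ?thesis by (rule AE_I') (auto simp: space_cut_measure)
qed

text \<open>Off \<open>Z\<close> every point is shifted into the interval, so there the preimage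
  under \<open>T\<close> is the shift preimage, whatever values \<open>T\<close> takes on the
  exceptional classes.\<close>

lemma shift_measure_preserving:
  assumes T: "T \<in> cut_quotient k N m U \<rightarrow> cut_quotient k N m U"
    and T_eq: "\<And>a. a \<in> X \<Longrightarrow> root_shift m c a \<in> X \<Longrightarrow>
      T (cut_class k N m U a) = cut_class k N m U (root_shift m c a)"
  shows "measure_preserving_transformation (cut_measure k N m U) T"
proof -
  obtain Z where Z: "Z \<in> internals" "power_density N m Z = 0"
    "\<And>a b. a \<in> X \<Longrightarrow> b \<in> X \<Longrightarrow> cut_equiv m U a b \<Longrightarrow> root_shift m c b \<notin> X \<Longrightarrow> a \<in> Z"
    using right_end_null by blast
  interpret loeb: finite_measure "loeb_measure k N m" by (rule finite_measure_loeb)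
  have main: "T -` E \<inter> cut_quotient k N m U \<in> cut_sets \<and>
      emeasure (loeb_measure k N m) (cut_preimage (T -` E \<inter> cut_quotient k N m U)) =
      emeasure (loeb_measure k N m) (cut_preimage E)" if E: "E \<in> cut_sets" for E
  proof -
    let ?B = "cut_preimage E" and ?B' = "cut_preimage (T -` E \<inter> cut_quotient k N m U)"
    have B: "?B \<in> sets (loeb_measure k N m)" using E by (simp add: cut_sets_def)
    have sat: "b \<in> ?B" if "a \<in> ?B" "b \<in> X" "cut_equiv m U a b" for a b
      using that cut_class_eq_iff[of a b] by auto
    have B': "a \<in> ?B' \<longleftrightarrow> root_shift m c a \<in> ?B" if "a \<in> X" "a \<notin> Z" for a
    proof -
      have "root_shift m c a \<in> X"
        using Z(3)[OF that(1) that(1)] that X_subset cut_equiv_refl by blast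
      then show ?thesis using that T_eq[OF that(1)] by (auto simp: cut_quotient_def)
    qed
    have "?B' \<in> sets (loeb_measure k N m)" "measure (loeb_measure k N m) ?B' = measure (loeb_measure k N m) ?B"
      using shift_vimage_loeb[of ?B Z ?B', OF B sat Z(1,2) _ B'] by auto
    then show ?thesis by (auto simp: cut_sets_def loeb.emeasure_eq_measure)
  qed
  show ?thesis
    unfolding measure_preserving_transformation_def
  proof (intro conjI ballI)
    show "T \<in> measurable (cut_measure k N m U) (cut_measure k N m U)"
      using T main by (auto simp: measurable_def sets_cut_measure space_cut_measure)
    fix E assume "E \<in> sets (cut_measure k N m U)"
    then show "emeasure (cut_measure k N m U) (T -` E \<inter> space (cut_measure k N m U)) = emeasure (cut_measure k N m U) E"
      using main[of E] by (simp add: sets_cut_measure space_cut_measure emeasure_cut_measure)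
  qed
qed

end

theorem theorem4p8:
  fixes m :: nat
    and N k c :: "'a::countably_saturated_extension"
    and U U\<^sub>N :: "'a set"
  assumes "m \<ge> 1"
    and "N \<in> hnats" and "infinite_number N"
    and "k \<in> hnats"
    and "additive_cut U" and "U \<subseteq> hinterval (std (Real 1)) N"
    and "largest_additive_cut N U\<^sub>N"
    and "c \<in> U\<^sub>N - U"
  shows
    \<comment> \<open>the value \<open>T\<^sub>c [a] = [(\<lceil>root m a\<rceil> + c)^m]\<close> does not depend on the representative\<close>
    "(\<forall>a\<in>power_interval k N m. \<forall>b\<in>power_interval k N m.
        cut_equiv m U a b \<longrightarrow>
        root_shift m c a \<in> power_interval k N m \<longrightarrow> root_shift m c b \<in> power_interval k N m \<longrightarrow>
        cut_class k N m U (root_shift m c a) = cut_class k N m U (root_shift m c b))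
     \<and> \<comment> \<open>it is defined almost everywhere (the shifted point may leave the interval at its right end)\<close>
     (AE g in cut_measure k N m U. \<forall>a\<in>g. root_shift m c a \<in> power_interval k N m)
     \<and> \<comment> \<open>and, whatever its values on the null set where it is undefined, \<open>T\<^sub>c\<close> preserves the measure\<close>
     (\<forall>T. T \<in> cut_quotient k N m U \<rightarrow> cut_quotient k N m U \<longrightarrow>
        (\<forall>a\<in>power_interval k N m. root_shift m c a \<in> power_interval k N m \<longrightarrow>
           T (cut_class k N m U a) = cut_class k N m U (root_shift m c a)) \<longrightarrow>
        measure_preserving_transformation (cut_measure k N m U) T)"
proof -
  interpret cut_shift_setup m N k U U\<^sub>N c
    using assms by unfold_locales auto
  show ?thesis
    using cut_equiv_root_shift cut_class_eq_iff root_shift_AE_defined shift_measure_preserving by blast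
qed

end
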